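(* For every integer $n\ge 1$, the number of $n\times n$ monomer-dimer tatami tilings (with any number of monomers) is $2^{n-1}(3n-4)+2$.
   Context: The $n\times n$ grid is the square $[0,n]\times[0,n]$ divided into $n^2$ unit grid squares. A monomer is a single grid square ($1\times 1$ tile); a dimer is a tile consisting of two edge-adjacent grid squares, either horizontal ($2\times 1$) or vertical ($1\times 2$). A monomer-dimer tiling of the grid is a partition of all its grid squares into monomers and dimers. A monomer-dimer tatami tiling is a monomer-dimer tiling in which no four (distinct) tiles meet at any point. Tilings are counted as labelled configurations on the fixed grid, i.e. rotations and reflections of a tiling count as different tilings if they differ as partitions of the grid. *)

theory Defs
  imports Complex_Main "HOL-Library.Disjoint_Sets"
begin

text \<open>
  The pair \<open>(i, j)\<close> names the grid square \<open>[i, i + 1] \<times> [j, j + 1]\<close>, and tiles are finite sets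
  of such names. The plane regions enter only through the tatami condition.
\<close>

type_synonym square = "nat \<times> nat"

type_synonym tile = "square set"

definition grid :: "nat \<Rightarrow> square set" where
  "grid n = {..<n} \<times> {..<n}"

definition monomer :: "tile \<Rightarrow> bool" where
  "monomer t \<longleftrightarrow> (\<exists>i j. t = {(i, j)})"

definition horizontal_dimer :: "tile \<Rightarrow> bool" where
  "horizontal_dimer t \<longleftrightarrow> (\<exists>i j. t = {(i, j), (i + 1, j)})"

definition vertical_dimer :: "tile \<Rightarrow> bool" where
  "vertical_dimer t \<longleftrightarrow> (\<exists>i j. t = {(i, j), (i, j + 1)})"

definition dimer :: "tile \<Rightarrow> bool" where
  "dimer t \<longleftrightarrow> horizontal_dimer t \<or> vertical_dimer t"

definition monomer_dimer_tiling :: "nat \<Rightarrow> tile set \<Rightarrow> bool" where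
  "monomer_dimer_tiling n T \<longleftrightarrow> partition_on (grid n) T \<and> (\<forall>t\<in>T. monomer t \<or> dimer t)"

definition square_region :: "square \<Rightarrow> (real \<times> real) set" where
  "square_region = (\<lambda>(i, j). {real i..real i + 1} \<times> {real j..real j + 1})"

definition tile_region :: "tile \<Rightarrow> (real \<times> real) set" where
  "tile_region t = (\<Union>s\<in>t. square_region s)"

text \<open>
  Regions are closed, so tiles meet at a point exactly when the point lies in each of their regions.
\<close>

definition tatami :: "tile set \<Rightarrow> bool" where
  "tatami T \<longleftrightarrow> \<not> (\<exists>p. \<exists>S\<subseteq>T. card S = 4 \<and> (\<forall>t\<in>S. p \<in> tile_region t))"

definition tatami_tilings :: "nat \<Rightarrow> tile set set" where
  "tatami_tilings n = {T. monomer_dimer_tiling n T \<and> tatami T}"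

end

theory Submission imports Defs begin

text \<open>
  Call a square of a tiling forward if its partner in a dimer lies to the right of it or above it,
  and backward if its partner lies to the left of it or below it; the other squares are monomers.
  The squares \<open>(x, y)\<close> and \<open>(x + 1, y + 1)\<close> are diagonal neighbours at an interior grid point, and
  some dimer covers two of the four squares around that point iff the first is forward or the
  second is backward. So the tatami condition says that along every diagonal \<open>x - y = w\<close> the
  squares are forward up to some place, then there is at most one monomer, and then all squares
  are backward.

  Every dimer joins two neighbouring diagonals, so a tiling can be read diagonal by diagonal, from a
  corner, where the diagonal has one square, to the main diagonal, and likewise from the
  opposite corner. All that one diagonal has to tell the next, longer one is its profile: which of
  its squares are matched to the longer diagonal, and whether forward or backward. Because both
  diagonals are sorted, all dimers between them are matched in the same way (\<open>link_one_kind\<close>), so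
  that a profile is a set \<open>U\<close> of squares with a direction. The transition rule is almost
  deterministic: a forward profile \<open>U\<close> on a diagonal of \<open>k + 1\<close> squares comes from the
  complementary backward profile on the diagonal of \<open>k\<close> squares, and only if \<open>U\<close> is an initial
  segment can it also come from a forward profile, which is then one of two final segments
  (\<open>count_forward_generic\<close>, \<open>count_forward_initial\<close>). Backward profiles are mirror images
  (\<open>count_mirror\<close>).

  Let \<open>f n\<close> be the number of tilings. Glue the two halves at the main diagonal, and use the
  complement rule to extend the half that ends on the diagonal of \<open>n - 1\<close> squares by one step. This
  gives \<open>f n\<close> as the sum, over all nonempty \<open>U\<close>, of the number of walks to the forward profile \<open>U\<close>
  times the number of walks to the complementary forward profile, both on a diagonal of \<open>n\<close> squares
  (\<open>weaving_sum_eq\<close>). Going back one step in both factors turns this sum into twice the sum for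
  \<open>n - 1\<close>, twice the contribution of the initial segments, and a term for the full set \<open>U\<close>. The
  contribution involves only the counts of final segments and equals \<open>2 ^ (n - 1) - 1\<close>
  (\<open>suffix_sum_eq\<close>). The result is the recurrence
  \<open>f (k + 1) = 2 * f k + 2 * (2 ^ k - 1) + 2 ^ k\<close> with \<open>f 1 = 1\<close>.
\<close>

section \<open>Profiles of consecutive diagonals\<close>

text \<open>
  The squares of a diagonal are named by the smaller one of their two coordinates, so a diagonal of
  \<open>k\<close> squares is \<open>{..<k}\<close>. Its profile consists of the forward and of the backward squares whose
  partner lies on the neighbouring longer diagonal.
\<close>

type_synonym profile = "nat set \<times> nat set"

definition at_most_one :: "bool \<Rightarrow> bool \<Rightarrow> bool \<Rightarrow> bool \<Rightarrow> bool" where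
  "at_most_one a b c d \<longleftrightarrow>
    \<not> (a \<and> b) \<and> \<not> (a \<and> c) \<and> \<not> (a \<and> d) \<and> \<not> (b \<and> c) \<and> \<not> (b \<and> d) \<and> \<not> (c \<and> d)"

text \<open>
  The diagonal of \<open>k + 1\<close> squares has profile \<open>b\<close>, and its shorter neighbour has profile \<open>a\<close>. Below
  the main diagonal, the square \<open>y\<close> of the longer diagonal has the square \<open>y\<close> of the shorter one on its
  right and the square \<open>y - 1\<close> below it. So \<open>y\<close> is forward if it is in \<open>fst b\<close> or in \<open>snd a\<close>, and
  backward if it is in \<open>snd b\<close> or if \<open>y - 1\<close> is in \<open>fst a\<close>. The last conjunct is the tatami condition.
\<close>

definition link :: "nat \<Rightarrow> profile \<Rightarrow> profile \<Rightarrow> bool" where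
  "link k a b \<longleftrightarrow>
    fst a \<subseteq> {..<k} \<and> snd a \<subseteq> {..<k} \<and> fst b \<subseteq> {..k} \<and> snd b \<subseteq> {..k} \<and>
    (\<forall>y\<le>k. at_most_one (y \<in> fst b) (y \<in> snd a) (y \<in> snd b) (0 < y \<and> y - 1 \<in> fst a)) \<and>
    (\<forall>y<k. y \<in> fst b \<or> y \<in> snd a \<or> Suc y \<in> snd b \<or> y \<in> fst a)"

lemma finite_link: "finite {a. link k a b}"
proof (rule finite_subset)
  show "{a. link k a b} \<subseteq> Pow {..<k} \<times> Pow {..<k}"
    unfolding link_def by (auto simp: mem_Times_iff)
qed simp

lemma link_pred_bounded: "link k a b \<Longrightarrow> a \<in> Pow {..<k} \<times> Pow {..<k}"
  and link_succ_bounded: "link k a b \<Longrightarrow> b \<in> Pow {..<Suc k} \<times> Pow {..<Suc k}"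
  unfolding link_def by (auto simp: mem_Times_iff lessThan_Suc_atMost)

text \<open>
  A backward square is not forward, so the tatami condition makes its successor on the diagonal
  backward as well.
\<close>

lemma link_forward_before_backward:
  assumes l: "link k a b"
    and p: "p \<in> fst b \<or> p \<in> snd a" and q: "q \<in> snd b \<or> 0 < q \<and> q - 1 \<in> fst a"
  shows "p < q"
proof (rule ccontr)
  assume "\<not> p < q"
  then have "q \<le> p" by simp
  have pk: "p \<le> k" using p l unfolding link_def by auto
  have "p \<in> snd b \<or> 0 < p \<and> p - 1 \<in> fst a"
    using \<open>q \<le> p\<close> pk
  proof (induction p rule: dec_induct)
    case base
    then show ?case using q by simp
  next
    case (step i)
    then have "i < k" and i: "i \<in> snd b \<or> 0 < i \<and> i - 1 \<in> fst a" by auto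
    moreover have "i \<notin> fst b" "i \<notin> snd a"
      using l i \<open>i < k\<close> unfolding link_def at_most_one_def by (metis less_imp_le)+
    ultimately show ?case using l unfolding link_def by auto
  qed
  then show False using p l pk unfolding link_def at_most_one_def by metis
qed

text \<open>
  Let \<open>p\<close> be forward and \<open>q\<close> be backward in the profile \<open>b\<close>. On their own diagonal, sortedness gives
  \<open>p < q\<close>. Their partners on the longer diagonal are the backward square \<open>p + 1\<close> and the forward
  square \<open>q\<close>, so there it gives \<open>q < p + 1\<close>.
\<close>

lemma link_one_kind:
  assumes "link k a b" "link (Suc k) b c"
  shows "fst b = {} \<or> snd b = {}"
proof (rule ccontr)
  assume "\<not> ?thesis"
  then obtain p q where pq: "p \<in> fst b" "q \<in> snd b" by blast
  then have "p < q" using link_forward_before_backward[OF assms(1)] by blast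
  moreover have "q < Suc p"
    using link_forward_before_backward[OF assms(2), of q "Suc p"] pq by simp
  ultimately show False by simp
qed

section \<open>Walks through profiles\<close>

text \<open>
  A walk lists the profiles of the diagonals of \<open>0, 1, \<dots>, k\<close> squares; the diagonal of \<open>0\<close> squares is
  a fictitious one beyond the corner. The default value past \<open>k\<close> makes a walk unique as a function.
\<close>

definition walks :: "nat \<Rightarrow> profile \<Rightarrow> (nat \<Rightarrow> profile) set" where
  "walks k a = {f. f 0 = ({}, {}) \<and> (\<forall>j<k. link j (f j) (f (Suc j))) \<and> f k = a \<and>
     (\<forall>j>k. f j = ({}, {}))}"

lemma walks_0: "walks 0 a = (if a = ({}, {}) then {\<lambda>_. ({}, {})} else {})"
proof -
  have "f \<in> walks 0 a \<longleftrightarrow> f = (\<lambda>_. ({}, {})) \<and> a = ({}, {})" for f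
  proof
    assume f: "f \<in> walks 0 a"
    have "f j = ({}, {})" for j
      using f unfolding walks_def by (cases "j = 0") blast+
    moreover have "f 0 = a"
      using f unfolding walks_def by blast
    ultimately show "f = (\<lambda>_. ({}, {})) \<and> a = ({}, {})"
      by (metis ext)
  qed (simp add: walks_def)
  then show ?thesis by (simp add: set_eq_iff)
qed

lemma walks_Suc:
  "walks (Suc k) b = (\<Union>a\<in>{a. link k a b}. (\<lambda>f. f(Suc k := b)) ` walks k a)"
proof (intro equalityI subsetI)
  fix f assume f: "f \<in> walks (Suc k) b"
  have "f(Suc k := ({}, {})) \<in> walks k (f k)" "link k (f k) b"
    using f unfolding walks_def by auto
  moreover have "f = (f(Suc k := ({}, {})))(Suc k := b)"
    using f unfolding walks_def by auto
  ultimately show "f \<in> (\<Union>a\<in>{a. link k a b}. (\<lambda>f. f(Suc k := b)) ` walks k a)" by blast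
next
  fix f assume "f \<in> (\<Union>a\<in>{a. link k a b}. (\<lambda>f. f(Suc k := b)) ` walks k a)"
  then obtain a g where "link k a b" "g \<in> walks k a" "f = g(Suc k := b)" by auto
  then show "f \<in> walks (Suc k) b"
    unfolding walks_def by (auto simp: less_Suc_eq)
qed

lemma finite_walks: "finite (walks k a)"
proof (induction k arbitrary: a)
  case 0
  then show ?case by (simp add: walks_0)
next
  case (Suc k)
  then show ?case by (simp add: walks_Suc finite_link)
qed

definition count :: "nat \<Rightarrow> profile \<Rightarrow> nat" where
  "count k a = card (walks k a)"

lemma count_0: "count 0 a = (if a = ({}, {}) then 1 else 0)"
  by (simp add: count_def walks_0)

lemma count_Suc: "count (Suc k) b = (\<Sum>a | link k a b. count k a)"
proof -
  have inj: "inj_on (\<lambda>f. f(Suc k := b)) (walks k a)" for a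
  proof (rule inj_onI)
    fix f g assume f: "f \<in> walks k a" and g: "g \<in> walks k a"
      and eq: "f(Suc k := b) = g(Suc k := b)"
    show "f = g"
    proof
      fix j show "f j = g j"
        using f g fun_cong[OF eq, of j] unfolding walks_def by (cases "j = Suc k") auto
    qed
  qed
  have "card (walks (Suc k) b) = (\<Sum>a | link k a b. card ((\<lambda>f. f(Suc k := b)) ` walks k a))"
    unfolding walks_Suc
  proof (rule card_UN_disjoint)
    show "\<forall>a\<in>{a. link k a b}. \<forall>a'\<in>{a. link k a b}. a \<noteq> a' \<longrightarrow>
      (\<lambda>f. f(Suc k := b)) ` walks k a \<inter> (\<lambda>f. f(Suc k := b)) ` walks k a' = {}"
    proof (intro ballI impI)
      fix a a' :: profile assume "a \<noteq> a'"
      have "h k = c" if "h \<in> (\<lambda>f. f(Suc k := b)) ` walks k c" for h c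
        using that unfolding walks_def by auto
      then show "(\<lambda>f. f(Suc k := b)) ` walks k a \<inter> (\<lambda>f. f(Suc k := b)) ` walks k a' = {}"
        using \<open>a \<noteq> a'\<close> by blast
    qed
  qed (simp_all add: finite_link finite_walks)
  then show ?thesis
    by (simp add: count_def card_image inj)
qed

lemma count_nonzero_linked:
  assumes "count (Suc k) b \<noteq> 0"
  shows "\<exists>a. link k a b"
  using assms unfolding count_Suc
  by (metis (mono_tags) mem_Collect_eq sum.not_neutral_contains_not_neutral)

lemma count_nonzero_one_kind:
  assumes "count k a \<noteq> 0" "link k a b"
  shows "fst a = {} \<or> snd a = {}"
proof (cases k)
  case 0
  with assms show ?thesis by (auto simp: count_0 split: if_splits)
next
  case (Suc j)
  with assms show ?thesis using count_nonzero_linked link_one_kind by blast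
qed

text \<open>
  A walk may end in a profile that mixes the two directions, but it cannot be continued from there.
  Hence a sum over predecessors only needs the profiles of one direction.
\<close>

lemma count_Suc_support:
  assumes "finite A" "\<And>a. a \<in> A \<Longrightarrow> link k a b"
    and "\<And>a. link k a b \<Longrightarrow> fst a = {} \<or> snd a = {} \<Longrightarrow> a \<in> A"
  shows "count (Suc k) b = (\<Sum>a\<in>A. count k a)"
  unfolding count_Suc
proof (rule sum.mono_neutral_right)
  show "\<forall>a\<in>{a. link k a b} - A. count k a = 0"
    using assms(3) count_nonzero_one_kind by blast
qed (use assms(2) in \<open>auto simp: finite_link\<close>)

text \<open>
  If the shorter diagonal sends only backward squares and the longer one has only forward
  squares in its profile, then the longer one has no backward square at all. By the tatami condition
  its squares other than the last must then be forward, and each of them is matched either to the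
  shorter or to the longer neighbour.
\<close>

lemma link_backward_forward:
  assumes "U \<noteq> {}" "U \<subseteq> {..k}"
  shows "link k ({}, V) (U, {}) \<longleftrightarrow> V = {..<k} - U"
  using assms unfolding link_def at_most_one_def by auto

text \<open>
  Here \<open>V\<close> makes the squares \<open>v + 1\<close> with \<open>v \<in> V\<close> of the longer diagonal backward, and \<open>U\<close> is the set
  of its forward squares. Sortedness makes \<open>U\<close> an initial segment and the backward squares a final
  segment; the two values of \<open>V\<close> correspond to the absence or presence of a monomer between them.
\<close>

lemma link_forward_forward:
  assumes "V \<noteq> {}" "U \<noteq> {}"
  shows "link k (V, {}) (U, {}) \<longleftrightarrow>
    (\<exists>m>0. U = {..<m} \<and> m \<le> k \<and> (V = {m - 1..<k} \<or> V = {m..<k}))"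
proof
  assume l: "link k (V, {}) (U, {})"
  have V: "V \<subseteq> {..<k}" and U: "U \<subseteq> {..k}" using l unfolding link_def by auto
  have order: "u < Suc v" if "u \<in> U" "v \<in> V" for u v
    using link_forward_before_backward[OF l, of u "Suc v"] that by simp
  have cover: "y \<in> U \<or> y \<in> V" if "y < k" for y using l that unfolding link_def by auto
  define m where "m = Suc (Max U)"
  have "finite U" using U finite_subset by blast
  then have max: "Max U \<in> U" "\<And>u. u \<in> U \<Longrightarrow> u \<le> Max U" using assms by auto
  have Um: "U = {..<m}"
  proof (intro equalityI subsetI)
    fix y assume "y \<in> {..<m}"
    show "y \<in> U"
    proof (cases "y = Max U")
      case False
      then have "y < Max U" using \<open>y \<in> {..<m}\<close> m_def by simp
      moreover then have "y < k" using max U by fastforce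
      ultimately show ?thesis using cover[of y] order[OF max(1), of y] by auto
    qed (simp add: max)
  qed (use max in \<open>auto simp: m_def less_Suc_eq_le\<close>)
  have "0 < m" by (simp add: m_def)
  have lower: "v \<ge> m - 1" if "v \<in> V" for v using order[OF max(1) that] m_def by simp
  have upper: "v \<in> V" if "m \<le> v" "v < k" for v using cover[of v] that Um by simp
  have "m \<le> k"
  proof -
    obtain v where "v \<in> V" using assms by blast
    then show ?thesis using lower[of v] V m_def by auto
  qed
  moreover have "V = {m - 1..<k} \<or> V = {m..<k}"
  proof (cases "m - 1 \<in> V")
    case True
    have "V = {m - 1..<k}"
    proof (intro equalityI subsetI)
      fix v assume "v \<in> {m - 1..<k}"
      then show "v \<in> V" using True upper[of v] by (cases "v = m - 1") auto
    qed (use lower V in auto)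
    then show ?thesis ..
  next
    case False
    have "V = {m..<k}"
    proof (intro equalityI subsetI)
      fix v assume "v \<in> V"
      then have "v \<noteq> m - 1" "v \<ge> m - 1" "v < k" using lower False V by auto
      then show "v \<in> {m..<k}" by auto
    qed (use upper in auto)
    then show ?thesis ..
  qed
  ultimately show "\<exists>m>0. U = {..<m} \<and> m \<le> k \<and> (V = {m - 1..<k} \<or> V = {m..<k})"
    using Um \<open>0 < m\<close> by blast
next
  assume "\<exists>m>0. U = {..<m} \<and> m \<le> k \<and> (V = {m - 1..<k} \<or> V = {m..<k})"
  then obtain m where m: "0 < m" "m \<le> k" "U = {..<m}" "V = {m - 1..<k} \<or> V = {m..<k}"
    by blast
  from m(4) show "link k (V, {}) (U, {})"
    using m(1-3) by (elim disjE) (auto simp: link_def at_most_one_def)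
qed

lemma count_forward_generic:
  assumes "U \<noteq> {}" "U \<subseteq> {..k}" "\<And>m. 0 < m \<Longrightarrow> m \<le> k \<Longrightarrow> U \<noteq> {..<m}"
  shows "count (Suc k) (U, {}) = count k ({}, {..<k} - U)"
proof -
  have "count (Suc k) (U, {}) = (\<Sum>a\<in>{({}, {..<k} - U)}. count k a)"
  proof (rule count_Suc_support)
    fix a assume l: "link k a (U, {})" and "fst a = {} \<or> snd a = {}"
    then consider V where "a = ({}, V)" | V where "a = (V, {})" "V \<noteq> {}"
      by (cases a) auto
    then show "a \<in> {({}, {..<k} - U)}"
    proof cases
      case 1
      then show ?thesis using l link_backward_forward[OF assms(1,2)] by simp
    next
      case 2
      then show ?thesis using l link_forward_forward[of V U k] assms by blast
    qed
  qed (use assms link_backward_forward in auto)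
  then show ?thesis by simp
qed

lemma count_forward_full: "count (Suc k) ({..k}, {}) = count k ({}, {})"
proof -
  have "{..k} \<noteq> {..<m}" if "m \<le> k" for m
    using that by (metis atMost_iff lessThan_iff linorder_not_less order_refl)
  then have "count (Suc k) ({..k}, {}) = count k ({}, {..<k} - {..k})"
    by (intro count_forward_generic) auto
  moreover have "{..<k} - {..k} = {}" by auto
  ultimately show ?thesis by simp
qed

lemma count_forward_initial:
  assumes "0 < m" "m \<le> k"
  shows "count (Suc k) ({..<m}, {}) = count k ({}, {..<k} - {..<m}) +
    (count k ({m - 1..<k}, {}) + (if m < k then count k ({m..<k}, {}) else 0))"
proof -
  let ?A = "{({m - 1..<k}, {})} \<union> (if m < k then {({m..<k}, {})} else {})"
  let ?B = "{({}, {..<k} - {..<m})} :: profile set"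
  have ne: "{..<m} \<noteq> {}" and sub: "{..<m} \<subseteq> {..k}" using assms by auto
  have neV: "{m - 1..<k} \<noteq> {}" "{m - 1..<k} \<noteq> {m..<k}"
    using assms by (auto simp: set_eq_iff intro!: exI[of _ "m - 1"])
  have "count (Suc k) ({..<m}, {}) = (\<Sum>a\<in>?B \<union> ?A. count k a)"
  proof (rule count_Suc_support)
    fix a :: profile assume "a \<in> ?B \<union> ?A"
    then consider "a = ({}, {..<k} - {..<m})" | "a = ({m - 1..<k}, {})"
      | "m < k" "a = ({m..<k}, {})" by (auto split: if_splits)
    then show "link k a ({..<m}, {})"
    proof cases
      case 1
      then show ?thesis using link_backward_forward[OF ne sub] by simp
    next
      case 2
      then show ?thesis using link_forward_forward[OF neV(1) ne] assms by auto
    next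
      case 3
      then have "{m..<k} \<noteq> {}" by simp
      from link_forward_forward[OF this ne] 3 assms show ?thesis by auto
    qed
  next
    fix a assume l: "link k a ({..<m}, {})" and "fst a = {} \<or> snd a = {}"
    then consider V where "a = ({}, V)" | V where "a = (V, {})" "V \<noteq> {}"
      by (cases a) auto
    then show "a \<in> ?B \<union> ?A"
    proof cases
      case 1
      then show ?thesis using l link_backward_forward[OF ne sub] by simp
    next
      case 2
      then have "V = {m - 1..<k} \<or> V = {m..<k}"
        using l link_forward_forward[OF 2(2) ne] by (auto simp: lessThan_eq_iff)
      then show ?thesis using 2 by auto
    qed
  qed auto
  also have "\<dots> = (\<Sum>a\<in>?B. count k a) + (\<Sum>a\<in>?A. count k a)"
    by (rule sum.union_disjoint) (use neV in auto)
  also have "(\<Sum>a\<in>?A. count k a)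
    = count k ({m - 1..<k}, {}) + (if m < k then count k ({m..<k}, {}) else 0)"
    using neV by simp
  finally show ?thesis by simp
qed

section \<open>Reversing the diagonals\<close>

text \<open>
  The reflection in the antidiagonal reverses each diagonal and exchanges forward with backward.
\<close>

definition mirror :: "nat \<Rightarrow> nat set \<Rightarrow> nat set" where
  "mirror k U = {y. y < k \<and> k - 1 - y \<in> U}"

lemma mirror_subset: "mirror k U \<subseteq> {..<k}"
  by (auto simp: mirror_def)

lemma mirror_mirror: "U \<subseteq> {..<k} \<Longrightarrow> mirror k (mirror k U) = U"
  by (auto simp: mirror_def)

lemma mirror_empty [simp]: "mirror k {} = {}"
  by (simp add: mirror_def)

lemma link_mirror:
  assumes "link k (P, M) (P', M')"
  shows "link k (mirror k M, mirror k P) (mirror (Suc k) M', mirror (Suc k) P')"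
proof -
  have one: "at_most_one (y \<in> P') (y \<in> M) (y \<in> M') (0 < y \<and> y - 1 \<in> P)" if "y \<le> k" for y
    using assms that unfolding link_def by auto
  have face: "y \<in> P' \<or> y \<in> M \<or> Suc y \<in> M' \<or> y \<in> P" if "y < k" for y
    using assms that unfolding link_def by auto
  have sub: "M \<subseteq> {..<k}" "P \<subseteq> {..<k}" using assms unfolding link_def by auto
  have "at_most_one (y \<in> mirror (Suc k) M') (y \<in> mirror k P) (y \<in> mirror (Suc k) P')
      (0 < y \<and> y - 1 \<in> mirror k M)" if "y \<le> k" for y
  proof -
    have "y \<in> mirror k P \<longleftrightarrow> 0 < k - y \<and> k - y - 1 \<in> P"
      using that by (auto simp: mirror_def)
    moreover have "0 < y \<and> y - 1 \<in> mirror k M \<longleftrightarrow> k - y \<in> M"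
    proof (cases "y = 0")
      case True
      then show ?thesis using sub by auto
    next
      case False
      moreover from False have "k - 1 - (y - 1) = k - y" by simp
      ultimately show ?thesis using that by (auto simp: mirror_def)
    qed
    moreover have "y \<in> mirror (Suc k) M' \<longleftrightarrow> k - y \<in> M'" "y \<in> mirror (Suc k) P' \<longleftrightarrow> k - y \<in> P'"
      using that by (auto simp: mirror_def)
    ultimately show ?thesis using one[of "k - y"] unfolding at_most_one_def by auto
  qed
  moreover have "y \<in> mirror (Suc k) M' \<or> y \<in> mirror k P \<or> Suc y \<in> mirror (Suc k) P'
      \<or> y \<in> mirror k M" if "y < k" for y
    using face[of "k - 1 - y"] that by (auto simp: mirror_def Suc_diff_Suc)
  ultimately show ?thesis unfolding link_def
    using mirror_subset[of k] mirror_subset[of "Suc k"] by (auto simp: lessThan_Suc_atMost)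
qed

lemma count_mirror:
  assumes "P \<subseteq> {..<k}" "M \<subseteq> {..<k}"
  shows "count k (mirror k M, mirror k P) = count k (P, M)"
  using assms
proof (induction k arbitrary: P M)
  case 0
  then show ?case by (simp add: mirror_def)
next
  case (Suc k)
  let ?flip = "\<lambda>a. (mirror k (snd a), mirror k (fst a))"
  have flip: "?flip a \<in> {a. link k a (mirror (Suc k) M, mirror (Suc k) P)}"
    if "link k a (P, M)" for a P M
    using that link_mirror[of k "fst a" "snd a" P M] by simp
  have inv: "?flip (?flip a) = a" if "link k a b" for a b
    using that link_pred_bounded[OF that] by (cases a) (auto simp: mirror_mirror)
  have "count (Suc k) (P, M) = (\<Sum>a | link k a (P, M). count k a)"
    by (rule count_Suc)
  also have "\<dots> = (\<Sum>a | link k a (mirror (Suc k) M, mirror (Suc k) P). count k a)"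
  proof (rule sum.reindex_bij_witness[of _ ?flip ?flip])
    fix a assume a: "a \<in> {a. link k a (mirror (Suc k) M, mirror (Suc k) P)}"
    show "?flip a \<in> {a. link k a (P, M)}"
      using flip[of a "mirror (Suc k) M" "mirror (Suc k) P"] a Suc.prems
      by (simp add: mirror_mirror)
    show "?flip (?flip a) = a" using a inv by blast
  next
    fix a assume a: "a \<in> {a. link k a (P, M)}"
    then show "?flip (?flip a) = a" using inv by blast
    show "?flip a \<in> {a. link k a (mirror (Suc k) M, mirror (Suc k) P)}" using a flip by blast
    have "a \<in> Pow {..<k} \<times> Pow {..<k}" using a link_pred_bounded by blast
    then show "count k (?flip a) = count k a"
      using Suc.IH[of "fst a" "snd a"] by (simp add: mem_Times_iff)
  qed
  also have "\<dots> = count (Suc k) (mirror (Suc k) M, mirror (Suc k) P)"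
    by (rule count_Suc[symmetric])
  finally show ?case by simp
qed

lemma count_backward:
  assumes "U \<subseteq> {..<k}"
  shows "count k ({}, U) = count k (mirror k U, {})"
  using count_mirror[of "{}" k U] assms by simp

section \<open>Profiles that are empty or a segment\<close>

text \<open>
  An empty profile: no dimer leaves the triangle cut off by the diagonal.
\<close>

abbreviation count_closed :: "nat \<Rightarrow> nat" where
  "count_closed k \<equiv> count k ({}, {})"

text \<open>
  With an empty profile, the diagonal of \<open>k + 2\<close> squares is matched to its shorter neighbour except for a
  monomer at one of its two ends. So all squares of the neighbour are matched in one direction, and by
  \<open>count_forward_full\<close> the next shorter diagonal has again an empty profile.
\<close>

lemma count_closed_Suc_Suc: "count_closed (Suc (Suc k)) = 2 * count_closed k"
proof -
  let ?A = "{({..k}, {}), ({}, {..k})} :: profile set"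
  have "count_closed (Suc (Suc k)) = (\<Sum>a\<in>?A. count (Suc k) a)"
  proof (rule count_Suc_support)
    fix a :: profile assume "a \<in> ?A"
    then show "link (Suc k) a ({}, {})" unfolding link_def at_most_one_def by auto
  next
    fix a assume l: "link (Suc k) a ({}, {})" and "fst a = {} \<or> snd a = {}"
    then consider V where "a = ({}, V)" | V where "a = (V, {})" by (cases a) auto
    then show "a \<in> ?A" using l
      by cases (auto simp: link_def less_Suc_eq_le)
  qed simp
  also have "\<dots> = count (Suc k) ({..k}, {}) + count (Suc k) ({}, {..k})"
    by simp
  also have "count (Suc k) ({}, {..k}) = count (Suc k) ({..k}, {})"
  proof -
    have "mirror (Suc k) {..k} = {..k}" by (auto simp: mirror_def)
    then show ?thesis using count_backward[of "{..k}" "Suc k"] by (simp add: lessThan_Suc_atMost)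
  qed
  finally show ?thesis by (simp add: count_forward_full)
qed

lemma count_closed_1: "count_closed (Suc 0) = 1"
proof -
  have "{a. link 0 a ({}, {})} = {({}, {})}"
    unfolding link_def at_most_one_def by auto
  then show ?thesis by (simp add: count_Suc count_0)
qed

lemma count_closed_mult: "count_closed (Suc k) * count_closed k = 2 ^ k"
proof (induction k)
  case 0
  then show ?case by (simp add: count_closed_1 count_0)
next
  case (Suc k)
  then show ?case by (simp add: count_closed_Suc_Suc mult.commute)
qed

definition count_suffix :: "nat \<Rightarrow> nat \<Rightarrow> nat" where
  "count_suffix k l = count k ({k - l..<k}, {})"

lemma count_suffix_full: "count_suffix (Suc k) (Suc k) = count_closed k"
  using count_forward_full[of k] by (simp add: count_suffix_def atLeast0LessThan lessThan_Suc_atMost)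

lemma mirror_lessThan: "m \<le> k \<Longrightarrow> mirror k {..<m} = {k - m..<k}"
  by (auto simp: mirror_def)

lemma count_backward_initial: "m \<le> k \<Longrightarrow> count k ({}, {..<m}) = count_suffix k m"
  by (simp add: count_backward mirror_lessThan count_suffix_def)

lemma count_suffix_Suc:
  assumes "1 \<le> l" "l \<le> k"
  shows "count_suffix (Suc k) l = count_suffix k (Suc k - l)"
proof -
  let ?U = "{Suc k - l..<Suc k}"
  have "0 \<notin> ?U" using assms by auto
  then have "?U \<noteq> {..<m}" if "0 < m" for m using that by (metis lessThan_iff)
  then have "count (Suc k) (?U, {}) = count k ({}, {..<k} - ?U)"
    using assms by (intro count_forward_generic) auto
  also have "{..<k} - ?U = {..<Suc k - l}" using assms by auto
  finally show ?thesis using assms by (simp add: count_suffix_def count_backward_initial)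
qed

text \<open>
  The contribution of the extra predecessors in \<open>count_forward_initial\<close> to \<open>closing_sum\<close> below.
\<close>

definition suffix_sum :: "nat \<Rightarrow> nat" where
  "suffix_sum k = (\<Sum>m=1..k. count_suffix k m *
     (count_suffix k (Suc k - m) + (if m < k then count_suffix k (k - m) else 0)))"

text \<open>
  Write \<open>P k\<close> and \<open>R k\<close> for the two convolutions of \<open>count_suffix k\<close> with itself that make up
  \<open>suffix_sum k\<close>. The rule \<open>count_suffix_Suc\<close> reverses the lengths of final segments. It turns
  \<open>R (k + 1)\<close> into \<open>P k\<close>, and \<open>P (k + 1)\<close> into \<open>R k\<close> plus the two end terms, each of which is
  \<open>2 ^ (k - 1)\<close> by \<open>count_closed_mult\<close>. So \<open>P + R\<close> grows by \<open>2 ^ k\<close> in step \<open>k\<close>.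
\<close>

lemma suffix_sum_eq: "suffix_sum (Suc k) = 2 ^ Suc k - 1"
proof -
  define s where "s = count_suffix"
  define P R where "P k = (\<Sum>m=1..k. s k m * s k (Suc k - m))"
    and "R k = (\<Sum>m=1..<k. s k m * s k (k - m))" for k
  have split: "suffix_sum k = P k + R k" for k
  proof -
    have "(\<Sum>m=1..k. s k m * (if m < k then s k (k - m) else 0)) = R k"
      unfolding R_def by (rule sum.mono_neutral_cong_right) auto
    then show ?thesis
      unfolding suffix_sum_def P_def s_def by (simp add: distrib_left sum.distrib)
  qed
  have full: "s (Suc k) (Suc k) = count_closed k" for k
    by (simp add: s_def count_suffix_full)
  have s_Suc: "s (Suc k) l = s k (Suc k - l)" if "1 \<le> l" "l \<le> k" for k l
    using that by (simp add: s_def count_suffix_Suc)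
  have R: "R (Suc k) = P k" for k
    unfolding R_def P_def
  proof (rule sum.cong)
    fix m assume m: "m \<in> {1..k}"
    then have "1 \<le> Suc k - m" "Suc k - m \<le> k" "Suc k - (Suc k - m) = m" by auto
    with m show "s (Suc k) m * s (Suc k) (Suc k - m) = s k m * s k (Suc k - m)"
      using s_Suc[of m k] s_Suc[of "Suc k - m" k] by simp
  qed auto
  have P: "P (Suc (Suc k)) = 2 ^ Suc k + R (Suc k)" for k
  proof -
    let ?g = "\<lambda>m. s (Suc (Suc k)) m * s (Suc (Suc k)) (Suc (Suc (Suc k)) - m)"
    have s1: "s (Suc (Suc k)) (Suc 0) = count_closed k"
      using s_Suc[of 1 "Suc k"] full[of k] by simp
    have ends: "?g 1 = 2 ^ k" "?g (Suc (Suc k)) = 2 ^ k"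
      using s1 full[of "Suc k"] count_closed_mult[of k] by (simp_all add: mult.commute)
    have "P (Suc (Suc k)) = ?g 1 + (\<Sum>m=2..Suc k. ?g m) + ?g (Suc (Suc k))"
      unfolding P_def by (simp add: sum.atLeast_Suc_atMost numeral_2_eq_2)
    also have "(\<Sum>m=2..Suc k. ?g m) = (\<Sum>m=1..<Suc k. ?g (Suc m))"
      by (rule sum.reindex_bij_witness[of _ Suc "\<lambda>m. m - 1"]) auto
    also have "\<dots> = (\<Sum>m=1..<Suc k. s (Suc k) (Suc k - m) * s (Suc k) m)"
    proof (rule sum.cong)
      fix m assume "m \<in> {1..<Suc k}"
      then have "1 \<le> Suc (Suc k) - m" "Suc (Suc k) - m \<le> Suc k"
        "Suc (Suc k) - (Suc (Suc k) - m) = m" "Suc m \<le> Suc k" by auto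
      then show "?g (Suc m) = s (Suc k) (Suc k - m) * s (Suc k) m"
        using s_Suc[of "Suc m" "Suc k"] s_Suc[of "Suc (Suc k) - m" "Suc k"] by simp
    qed simp
    also have "\<dots> = R (Suc k)" unfolding R_def by (simp add: mult.commute)
    finally show ?thesis using ends by simp
  qed
  have "P (Suc k) + R (Suc k) + 1 = 2 ^ Suc k"
  proof (induction k)
    case 0
    have "s (Suc 0) (Suc 0) = 1" using full[of 0] by (simp add: count_0)
    then show ?case by (simp add: P_def R_def)
  next
    case (Suc k)
    then show ?case using P[of k] R[of "Suc k"] by simp
  qed
  then show ?thesis using split by (metis add_diff_cancel_right')
qed

section \<open>The recurrence\<close>

text \<open>
  Half of the ways to glue two walks at the main diagonal of a grid of side \<open>k + 1\<close> when some dimers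
  join it to the longest diagonal above it: there the profile is backward, and the corresponding
  squares of the main diagonal are forward.
\<close>

definition closing_sum :: "nat \<Rightarrow> nat" where
  "closing_sum k = (\<Sum>U\<in>Pow {..<k} - {{}}. count k ({}, U) * count (Suc k) (U, {}))"

definition complement_sum :: "nat \<Rightarrow> nat" where
  "complement_sum k = (\<Sum>U\<in>Pow {..<k} - {{}}. count k (U, {}) * count k ({..<k} - U, {}))"

lemma mirror_compl: "mirror k ({..<k} - U) = {..<k} - mirror k U"
  by (auto simp: mirror_def)

lemma mirror_nonempty:
  assumes "U \<in> Pow {..<k} - {{}}"
  shows "mirror k U \<in> Pow {..<k} - {{}}"
proof -
  have "mirror k U \<noteq> {}" using assms mirror_mirror[of U k] by auto
  then show ?thesis using mirror_subset by auto
qed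

lemma complement_sum_backward:
  "complement_sum k = (\<Sum>U\<in>Pow {..<k} - {{}}. count k ({}, U) * count k ({}, {..<k} - U))"
  unfolding complement_sum_def
proof (rule sum.reindex_bij_witness[of _ "mirror k" "mirror k"])
  fix U assume U: "U \<in> Pow {..<k} - {{}}"
  then show "mirror k (mirror k U) = U" by (simp add: mirror_mirror)
  show "mirror k U \<in> Pow {..<k} - {{}}" using U by (rule mirror_nonempty)
  have "count k ({}, mirror k U) = count k (U, {})"
    using count_backward[OF mirror_subset] U by (simp add: mirror_mirror)
  moreover have "count k ({}, {..<k} - mirror k U) = count k ({..<k} - U, {})"
    using count_backward[of "{..<k} - mirror k U" k] U by (simp add: mirror_compl mirror_mirror)
  ultimately show "count k ({}, mirror k U) * count k ({}, {..<k} - mirror k U)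
    = count k (U, {}) * count k ({..<k} - U, {})" by simp
qed (use mirror_nonempty in \<open>simp_all add: mirror_mirror\<close>)

text \<open>
  Replacing the second factor of each summand by its complementary predecessor gives
  \<open>complement_sum\<close> in its backward form; what is left are the extra predecessors of the
  initial segments.
\<close>

lemma closing_sum_eq: "closing_sum k = complement_sum k + suffix_sum k"
proof -
  \<comment> \<open>The truncated difference is exact, because the complementary profile is always a predecessor.\<close>
  define extra where "extra U = count (Suc k) (U, {}) - count k ({}, {..<k} - U)" for U
  have generic: "count (Suc k) (U, {}) = count k ({}, {..<k} - U) + extra U"
    and extra_0: "U \<notin> lessThan ` {1..k} \<Longrightarrow> extra U = 0"
    if U: "U \<in> Pow {..<k} - {{}}" for U
  proof -
    have "U \<subseteq> {..k}" "U \<noteq> {}" using U by auto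
    then have eq: "count (Suc k) (U, {}) = count k ({}, {..<k} - U)" if "U \<notin> lessThan ` {1..k}"
    proof (intro count_forward_generic)
      fix m assume "0 < m" "m \<le> k"
      then have "{..<m} \<in> lessThan ` {1..k}" by simp
      then show "U \<noteq> {..<m}" using that by metis
    qed
    then show "extra U = 0" if "U \<notin> lessThan ` {1..k}"
      using that by (simp add: extra_def)
    show "count (Suc k) (U, {}) = count k ({}, {..<k} - U) + extra U"
    proof (cases "U \<in> lessThan ` {1..k}")
      case True
      then obtain m where "0 < m" "m \<le> k" "U = {..<m}" by auto
      then show ?thesis using count_forward_initial[of m k] by (simp add: extra_def)
    qed (simp add: eq extra_def)
  qed
  have "closing_sum k = (\<Sum>U\<in>Pow {..<k} - {{}}. count k ({}, U) * count k ({}, {..<k} - U))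
    + (\<Sum>U\<in>Pow {..<k} - {{}}. count k ({}, U) * extra U)"
    unfolding closing_sum_def sum.distrib[symmetric]
    by (rule sum.cong) (simp_all add: generic distrib_left)
  also have "(\<Sum>U\<in>Pow {..<k} - {{}}. count k ({}, U) * extra U)
    = (\<Sum>U\<in>lessThan ` {1..k}. count k ({}, U) * extra U)"
    by (rule sum.mono_neutral_right) (use extra_0 in \<open>auto simp: lessThan_empty_iff\<close>)
  also have "\<dots> = (\<Sum>m=1..k. count k ({}, {..<m}) * extra {..<m})"
    by (subst sum.reindex) (auto intro: inj_onI)
  also have "\<dots> = suffix_sum k"
    unfolding suffix_sum_def
  proof (rule sum.cong)
    fix m assume m: "m \<in> {1..k}"
    then have "extra {..<m} = count_suffix k (Suc k - m) + (if m < k then count_suffix k (k - m) else 0)"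
      using count_forward_initial[of m k] by (auto simp: extra_def count_suffix_def)
    then show "count k ({}, {..<m}) * extra {..<m} = count_suffix k m *
      (count_suffix k (Suc k - m) + (if m < k then count_suffix k (k - m) else 0))"
      using m by (simp add: count_backward_initial)
  qed simp
  finally show ?thesis by (simp add: complement_sum_backward)
qed

text \<open>
  Complementing \<open>U\<close> permutes the proper nonempty subsets of \<open>{..<k + 1}\<close>, and exchanges those that contain \<open>k\<close>
  with those that do not. If \<open>k \<notin> U\<close>, then the complement of \<open>U\<close> contains \<open>k\<close> and is not the whole
  diagonal. Hence it is not an initial segment, and its only predecessor is the backward profile \<open>U\<close>. The
  last summand comes from \<open>U = {..<k + 1}\<close>.
\<close>

lemma complement_sum_Suc:
  "complement_sum (Suc k) = 2 * closing_sum k + count_closed (Suc k) * count_closed k"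
proof -
  define g where "g U = count (Suc k) (U, {}) * count (Suc k) ({..<Suc k} - U, {})" for U
  \<comment> \<open>The nonempty sets are those without \<open>k\<close>, the complements of these, and the full set.\<close>
  let ?lo = "Pow {..<k} - {{}}" and ?compl = "\<lambda>U. {..<Suc k} - U"
  have g_lo: "g U = count k ({}, U) * count (Suc k) (U, {})" if U: "U \<in> ?lo" for U
  proof -
    let ?C = "{..<Suc k} - U"
    have "k \<in> ?C" using U by auto
    then have "?C \<noteq> {..<m}" if "m \<le> k" for m
      using that by (metis lessThan_iff linorder_not_less)
    then have "count (Suc k) (?C, {}) = count k ({}, {..<k} - ?C)"
      using \<open>k \<in> ?C\<close> by (intro count_forward_generic) auto
    also have "{..<k} - ?C = U" using U by auto
    finally show ?thesis by (simp add: g_def)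
  qed
  have "Pow {..<Suc k} - {{}} = insert {..<Suc k} (?lo \<union> ?compl ` ?lo)"
  proof (intro equalityI subsetI)
    fix V assume V: "V \<in> Pow {..<Suc k} - {{}}"
    show "V \<in> insert {..<Suc k} (?lo \<union> ?compl ` ?lo)"
    proof (cases "k \<in> V")
      case True
      have V': "V = ?compl (?compl V)" using V by (simp add: double_diff)
      show ?thesis
      proof (cases "?compl V = {}")
        case True
        then have "V = {..<Suc k}" using V by auto
        then show ?thesis by (simp only: insertI1)
      next
        case False
        then have "?compl V \<in> ?lo" using \<open>k \<in> V\<close> by (auto simp: less_Suc_eq)
        then have "?compl (?compl V) \<in> ?compl ` ?lo" by (rule imageI)
        then show ?thesis using V' by (metis UnI2 insertI2)
      qed
    next
      case False
      with V have "V \<in> ?lo" by (auto simp: less_Suc_eq)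
      then show ?thesis by (intro insertI2 UnI1)
    qed
  next
    fix V assume "V \<in> insert {..<Suc k} (?lo \<union> ?compl ` ?lo)"
    then consider "V = {..<Suc k}" | "V \<in> ?lo" | U where "U \<in> ?lo" "V = ?compl U"
      by (elim insertE UnE imageE) auto
    then show "V \<in> Pow {..<Suc k} - {{}}"
    proof cases
      case 3
      then have "k \<in> V" by auto
      then show ?thesis using 3 by blast
    qed (auto simp: lessThan_empty_iff)
  qed
  moreover have "?lo \<inter> ?compl ` ?lo = {}"
  proof -
    have "k \<notin> U" "k \<in> ?compl U" if "U \<in> ?lo" for U using that by auto
    then show ?thesis by (metis (no_types, lifting) disjoint_iff imageE)
  qed
  moreover have "{..<Suc k} \<notin> ?lo \<union> ?compl ` ?lo"
  proof -
    have "?compl U \<noteq> {..<Suc k}" "U \<noteq> {..<Suc k}" if "U \<in> ?lo" for U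
    proof -
      have "U \<subseteq> {..<Suc k}" "U \<noteq> {}" using that by auto
      then show "?compl U \<noteq> {..<Suc k}" by blast
      show "U \<noteq> {..<Suc k}" using that by auto
    qed
    then show ?thesis by (metis (no_types, lifting) UnE imageE)
  qed
  ultimately have "complement_sum (Suc k) = g {..<Suc k} + (sum g ?lo + sum g (?compl ` ?lo))"
    unfolding complement_sum_def g_def[symmetric] by (simp add: sum.union_disjoint)
  moreover have "sum g ?lo = closing_sum k"
    unfolding closing_sum_def by (rule sum.cong) (simp_all add: g_lo)
  moreover have "sum g (?compl ` ?lo) = sum g ?lo"
  proof -
    have inv: "?compl (?compl U) = U" if "U \<in> ?lo" for U using that by auto
    then have "inj_on ?compl ?lo" by (rule inj_on_inverseI)
    then have "sum g (?compl ` ?lo) = (\<Sum>U\<in>?lo. g (?compl U))" by (simp add: sum.reindex)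
    also have "\<dots> = sum g ?lo"
      by (rule sum.cong) (simp_all only: g_def inv mult.commute)
    finally show ?thesis .
  qed
  moreover have "g {..<Suc k} = count_closed (Suc k) * count_closed k"
    using count_forward_full[of k] by (simp add: g_def lessThan_Suc_atMost)
  ultimately show ?thesis by simp
qed

text \<open>
  The argument of \<open>link_one_kind\<close>, applied across the main diagonal.
\<close>

lemma weaving_one_kind:
  assumes a: "count k b \<noteq> 0" and c: "count (Suc k) (snd b, Suc ` fst b) \<noteq> 0"
  shows "fst b = {} \<or> snd b = {}"
proof (rule ccontr)
  assume "\<not> ?thesis"
  then obtain p q where pq: "p \<in> fst b" "q \<in> snd b" by blast
  obtain a' where l: "link k a' (snd b, Suc ` fst b)" using c count_nonzero_linked by blast
  have "q < Suc p" using link_forward_before_backward[OF l, of q "Suc p"] pq by simp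
  moreover have "p < q"
  proof (cases k)
    case 0
    then show ?thesis using a pq by (auto simp: count_0 split: if_splits)
  next
    case (Suc j)
    then obtain a'' where "link j a'' b" using a count_nonzero_linked by blast
    then show ?thesis using link_forward_before_backward pq by blast
  qed
  ultimately show False by simp
qed

text \<open>
  The number of ways to glue two walks at the main diagonal. Let \<open>b\<close> be the profile of the longest
  diagonal above the main one, read after reflection in the main diagonal, which preserves
  directions. The backward square \<open>y\<close> of \<open>b\<close> has the forward square \<open>y\<close> of the main diagonal
  as its partner, and its forward square \<open>y\<close> has the backward square \<open>y + 1\<close>. So the main diagonal acts
  as the last diagonal of a walk through the lower half that ends in \<open>(snd b, Suc ` fst b)\<close>.
\<close>

definition weaving_sum :: "nat \<Rightarrow> nat" where
  "weaving_sum k =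
    (\<Sum>b\<in>Pow {..<k} \<times> Pow {..<k}. count k b * count (Suc k) (snd b, Suc ` fst b))"

lemma mirror_Suc_image: "mirror (Suc k) (Suc ` U) = mirror k U"
proof (intro set_eqI)
  fix y
  have "k - y \<in> Suc ` U \<longleftrightarrow> 0 < k - y \<and> k - y - 1 \<in> U"
    by (cases "k - y") auto
  then show "y \<in> mirror (Suc k) (Suc ` U) \<longleftrightarrow> y \<in> mirror k U"
    by (auto simp: mirror_def)
qed

text \<open>
  The profile \<open>b\<close> is empty, backward or forward. The last two cases contribute equally, by
  reversal, and the three of them together are the right-hand side of \<open>complement_sum_Suc\<close>.
\<close>

lemma weaving_sum_eq: "weaving_sum k = complement_sum (Suc k)"
proof -
  let ?F = "Pow {..<k} - {{}} :: nat set set"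
  let ?t = "\<lambda>b. count k b * count (Suc k) (snd b, Suc ` fst b)"
  let ?A = "(\<lambda>U. ({}, U)) ` ?F" and ?B = "(\<lambda>U. (U, {})) ` ?F"
  have "weaving_sum k = sum ?t (insert ({}, {}) (?A \<union> ?B))"
    unfolding weaving_sum_def
  proof (rule sum.mono_neutral_right)
    show "insert ({}, {}) (?A \<union> ?B) \<subseteq> Pow {..<k} \<times> Pow {..<k}" by auto
    show "\<forall>b\<in>Pow {..<k} \<times> Pow {..<k} - insert ({}, {}) (?A \<union> ?B). ?t b = 0"
    proof
      fix b assume b: "b \<in> Pow {..<k} \<times> Pow {..<k} - insert ({}, {}) (?A \<union> ?B)"
      have "\<not> (fst b = {} \<or> snd b = {})"
      proof
        assume "fst b = {} \<or> snd b = {}"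
        then have "b = ({}, snd b) \<or> b = (fst b, {})" by (metis prod.collapse)
        then show False using b by (auto simp: image_iff)
      qed
      then show "?t b = 0" using weaving_one_kind[of k b] by auto
    qed
  qed simp
  also have "\<dots> = ?t ({}, {}) + (sum ?t ?A + sum ?t ?B)"
    by (subst sum.insert, simp, force, subst sum.union_disjoint) auto
  also have "sum ?t ?A = closing_sum k"
    unfolding closing_sum_def by (subst sum.reindex) (auto intro: inj_onI)
  also have "sum ?t ?B = (\<Sum>U\<in>?F. count k (U, {}) * count (Suc k) ({}, Suc ` U))"
    by (subst sum.reindex) (auto intro: inj_onI)
  also have "\<dots> = closing_sum k"
    unfolding closing_sum_def
  proof (rule sum.reindex_bij_witness[of _ "mirror k" "mirror k"])
    fix U assume U: "U \<in> ?F"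
    have "Suc ` U \<subseteq> {..<Suc k}" using U by auto
    then have "count (Suc k) ({}, Suc ` U) = count (Suc k) (mirror k U, {})"
      using U count_backward[of "Suc ` U" "Suc k"] by (simp add: mirror_Suc_image)
    moreover have "count k ({}, mirror k U) = count k (U, {})"
      using count_backward[OF mirror_subset] U by (simp add: mirror_mirror)
    ultimately show "count k ({}, mirror k U) * count (Suc k) (mirror k U, {})
      = count k (U, {}) * count (Suc k) ({}, Suc ` U)" by simp
  qed (use mirror_nonempty in \<open>simp_all add: mirror_mirror\<close>)
  finally show ?thesis by (simp add: complement_sum_Suc)
qed

lemma complement_sum_closed_form:
  "int (complement_sum (Suc k)) = 2 ^ k * (3 * int (Suc k) - 4) + 2"
proof (induction k)
  case 0
  have "complement_sum 0 = 0" "suffix_sum 0 = 0" by (simp_all add: complement_sum_def suffix_sum_def)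
  then show ?case using complement_sum_Suc[of 0] count_closed_mult[of 0]
    by (simp add: closing_sum_eq)
next
  case (Suc k)
  have "suffix_sum (Suc k) + 1 = 2 ^ Suc k" by (simp add: suffix_sum_eq)
  then have "int (suffix_sum (Suc k)) = 2 ^ Suc k - 1"
    by (metis add_diff_cancel_right' of_nat_1 of_nat_add of_nat_numeral of_nat_power)
  moreover have "complement_sum (Suc (Suc k))
      = 2 * (complement_sum (Suc k) + suffix_sum (Suc k)) + 2 ^ Suc k"
    by (simp only: complement_sum_Suc[of "Suc k"] closing_sum_eq count_closed_mult)
  ultimately show ?case using Suc.IH by (simp add: algebra_simps)
qed

section \<open>Layouts of dimers and pairs of walks\<close>

text \<open>
  A tiling is determined by the set \<open>H\<close> of the left squares of its horizontal dimers and the set \<open>V\<close>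
  of the lower squares of its vertical dimers. The first conjunct says that the dimers do not overlap at
  \<open>(x, y)\<close>, the second is the tatami condition at the upper right corner of this square.
\<close>

definition cell_fits :: "nat \<Rightarrow> square set \<Rightarrow> square set \<Rightarrow> nat \<Rightarrow> nat \<Rightarrow> bool" where
  "cell_fits n H V x y \<longleftrightarrow>
    at_most_one ((x, y) \<in> V) ((x, y) \<in> H) (0 < x \<and> (x - 1, y) \<in> H) (0 < y \<and> (x, y - 1) \<in> V) \<and>
    (Suc x < n \<and> Suc y < n \<longrightarrow>
      (x, y) \<in> V \<or> (x, y) \<in> H \<or> (x, Suc y) \<in> H \<or> (Suc x, y) \<in> V)"

definition in_bounds :: "nat \<Rightarrow> square set \<Rightarrow> square set \<Rightarrow> bool" where
  "in_bounds n H V \<longleftrightarrow>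
    (\<forall>(x, y)\<in>H. Suc x < n \<and> y < n) \<and> (\<forall>(x, y)\<in>V. x < n \<and> Suc y < n)"

definition layouts :: "nat \<Rightarrow> (square set \<times> square set) set" where
  "layouts n = {(H, V). in_bounds n H V \<and> (\<forall>x<n. \<forall>y<n. cell_fits n H V x y)}"

text \<open>
  For \<open>j < n\<close> this is the profile of the diagonal \<open>x - y = n - j\<close>, which has \<open>j\<close> squares. For
  \<open>j = n\<close> it describes the dimers that join the main diagonal to the diagonal above it. The
  diagonals above the main one are covered by transposing the layout, which exchanges \<open>H\<close> and \<open>V\<close>.
\<close>

definition diagonal_profile :: "nat \<Rightarrow> square set \<Rightarrow> square set \<Rightarrow> nat \<Rightarrow> profile" where
  "diagonal_profile n H V j =
    ({y. (n - j + y, y) \<in> V}, {y. 0 < n - j + y \<and> (n - j + y - 1, y) \<in> H})"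

lemma in_bounds_transpose: "in_bounds n (V\<inverse>) (H\<inverse>) = in_bounds n H V"
  unfolding in_bounds_def by auto

lemma cell_fits_transpose: "cell_fits n (V\<inverse>) (H\<inverse>) x y = cell_fits n H V y x"
  unfolding cell_fits_def at_most_one_def by auto

lemma link_diagonal_profile:
  assumes "in_bounds (Suc N) H V" "j \<le> N"
  shows "link j (diagonal_profile (Suc N) H V j) (diagonal_profile (Suc N) H V (Suc j)) \<longleftrightarrow>
    (\<forall>y\<le>j. cell_fits (Suc N) H V (N - j + y) y)"
proof -
  let ?a = "diagonal_profile (Suc N) H V j" and ?b = "diagonal_profile (Suc N) H V (Suc j)"
  have V: "x \<le> N" "y < N" if "(x, y) \<in> V" for x y
    using assms(1) that unfolding in_bounds_def by auto
  have H: "x < N" "y \<le> N" if "(x, y) \<in> H" for x y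
    using assms(1) that unfolding in_bounds_def by auto
  have bounds: "fst ?a \<subseteq> {..<j}" "snd ?a \<subseteq> {..<j}" "fst ?b \<subseteq> {..j}" "snd ?b \<subseteq> {..j}"
    using assms(2) by (force simp: diagonal_profile_def dest!: V(1) H(1))+
  have b: "y \<in> fst ?b \<longleftrightarrow> (N - j + y, y) \<in> V"
    "y \<in> snd ?b \<longleftrightarrow> 0 < N - j + y \<and> (N - j + y - 1, y) \<in> H" for y
    by (simp_all add: diagonal_profile_def)
  have a: "y \<in> snd ?a \<longleftrightarrow> (N - j + y, y) \<in> H" "y \<in> fst ?a \<longleftrightarrow> (Suc (N - j + y), y) \<in> V" for y
    using assms(2) by (simp_all add: diagonal_profile_def Suc_diff_le)
  have a': "0 < y \<and> y - 1 \<in> fst ?a \<longleftrightarrow> 0 < y \<and> (N - j + y, y - 1) \<in> V" for y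
    by (cases y) (simp_all add: a)
  have b': "Suc y \<in> snd ?b \<longleftrightarrow> (N - j + y, Suc y) \<in> H" for y
    by (simp add: b)
  have c: "Suc (N - j + y) < Suc N \<and> Suc y < Suc N \<longleftrightarrow> y < j" if "y \<le> j" for y
    using that assms(2) by auto
  have "link j ?a ?b \<longleftrightarrow>
    (\<forall>y\<le>j. at_most_one (y \<in> fst ?b) (y \<in> snd ?a) (y \<in> snd ?b) (0 < y \<and> y - 1 \<in> fst ?a) \<and>
      (y < j \<longrightarrow> y \<in> fst ?b \<or> y \<in> snd ?a \<or> Suc y \<in> snd ?b \<or> y \<in> fst ?a))"
    unfolding link_def using bounds by (meson less_imp_le)
  also have "\<dots> \<longleftrightarrow> (\<forall>y\<le>j. cell_fits (Suc N) H V (N - j + y) y)"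
    by (intro all_cong) (simp only: cell_fits_def a' b' c, simp only: a b)
  finally show ?thesis .
qed

text \<open>
  The link at the diagonal of \<open>j + 1\<close> squares is the condition \<open>cell_fits\<close> on that diagonal. The bound
  \<open>m\<close> selects all diagonals weakly below the main one for \<open>m = Suc N\<close>, and those strictly below for \<open>m = N\<close>.
\<close>

lemma all_links_diagonal_profile:
  assumes "in_bounds (Suc N) H V" "m \<le> Suc N"
  shows "(\<forall>j<m. link j (diagonal_profile (Suc N) H V j) (diagonal_profile (Suc N) H V (Suc j)))
    \<longleftrightarrow> (\<forall>x\<le>N. \<forall>y\<le>x. N < m + (x - y) \<longrightarrow> cell_fits (Suc N) H V x y)"
proof -
  have "(\<forall>j<m. \<forall>y\<le>j. cell_fits (Suc N) H V (N - j + y) y) \<longleftrightarrow>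
    (\<forall>x\<le>N. \<forall>y\<le>x. N < m + (x - y) \<longrightarrow> cell_fits (Suc N) H V x y)" (is "?L \<longleftrightarrow> ?R")
  proof
    assume L: ?L
    show ?R
    proof (intro allI impI)
      fix x y assume "x \<le> N" "y \<le> x" "N < m + (x - y)"
      then show "cell_fits (Suc N) H V x y"
        using L[rule_format, of "N - (x - y)" y] by auto
    qed
  next
    assume R: ?R
    show ?L
    proof (intro allI impI)
      fix j y assume "j < m" "y \<le> j"
      then show "cell_fits (Suc N) H V (N - j + y) y"
        using R[rule_format, of "N - j + y" y] assms(2) by auto
    qed
  qed
  then show ?thesis using link_diagonal_profile[OF assms(1)] assms(2) by auto
qed

lemma layouts_iff_links:
  assumes "in_bounds (Suc N) H V"
  shows "(H, V) \<in> layouts (Suc N) \<longleftrightarrow>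
    (\<forall>j<Suc N. link j (diagonal_profile (Suc N) H V j) (diagonal_profile (Suc N) H V (Suc j))) \<and>
    (\<forall>j<N. link j (diagonal_profile (Suc N) (V\<inverse>) (H\<inverse>) j)
      (diagonal_profile (Suc N) (V\<inverse>) (H\<inverse>) (Suc j)))"
proof -
  have "in_bounds (Suc N) (V\<inverse>) (H\<inverse>)" using assms by (simp add: in_bounds_transpose)
  note upper = all_links_diagonal_profile[OF this, of N]
  note lower = all_links_diagonal_profile[OF assms, of "Suc N"]
  have "(H, V) \<in> layouts (Suc N) \<longleftrightarrow> (\<forall>x\<le>N. \<forall>y\<le>N. cell_fits (Suc N) H V x y)"
    using assms by (simp add: layouts_def less_Suc_eq_le)
  also have "\<dots> \<longleftrightarrow> (\<forall>x\<le>N. \<forall>y\<le>x. N < Suc N + (x - y) \<longrightarrow> cell_fits (Suc N) H V x y) \<and>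
      (\<forall>x\<le>N. \<forall>y\<le>x. N < N + (x - y) \<longrightarrow> cell_fits (Suc N) H V y x)"
    (is "?L \<longleftrightarrow> ?R")
  proof
    assume ?L
    then show ?R by auto
  next
    assume R: ?R
    show ?L
    proof (intro allI impI)
      fix x y assume "x \<le> N" "y \<le> N"
      then show "cell_fits (Suc N) H V x y" using R by (cases "y \<le> x") auto
    qed
  qed
  finally show ?thesis unfolding lower[OF order_refl] upper[OF le_SucI[OF order_refl]]
    by (simp only: cell_fits_transpose)
qed

text \<open>
  The horizontal dimers encoded by a walk \<open>f\<close> through the lower half and a walk \<open>g\<close> through the
  transposed upper half. Below the main diagonal the right square of a horizontal dimer is a
  backward square on the shorter diagonal. Above it the left square lies on the shorter diagonal and is
  forward. The vertical dimers are obtained by exchanging \<open>f\<close> with \<open>g\<close> and transposing.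
\<close>

definition weave :: "nat \<Rightarrow> (nat \<Rightarrow> profile) \<Rightarrow> (nat \<Rightarrow> profile) \<Rightarrow> square set" where
  "weave N f g = {(x, y). if y \<le> x then x \<le> N \<and> y \<in> snd (f (N - (x - y)))
     else y \<le> N \<and> x \<in> fst (g (Suc N - (y - x)))}"

lemma in_bounds_weave:
  assumes f: "\<And>j. j \<le> N \<Longrightarrow> f j \<in> Pow {..<j} \<times> Pow {..<j}"
    and g: "\<And>j. j \<le> N \<Longrightarrow> g j \<in> Pow {..<j} \<times> Pow {..<j}"
  shows "in_bounds (Suc N) (weave N f g) ((weave N g f)\<inverse>)"
proof -
  have "Suc x < Suc N \<and> y < Suc N" if xy: "(x, y) \<in> weave N f g"
    and f: "\<And>j. j \<le> N \<Longrightarrow> f j \<in> Pow {..<j} \<times> Pow {..<j}" for x y f g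
  proof (cases "y \<le> x")
    case True
    then have "x \<le> N" "y \<in> snd (f (N - (x - y)))" using xy by (auto simp: weave_def)
    then have "y < N - (x - y)" using f[of "N - (x - y)"] by (auto simp: mem_Times_iff)
    then show ?thesis using True \<open>x \<le> N\<close> by simp
  next
    case False
    then show ?thesis using xy by (auto simp: weave_def)
  qed
  from this[OF _ f] this[OF _ g] show ?thesis unfolding in_bounds_def by auto
qed

lemma diagonal_profile_weave:
  assumes "j \<le> N" "f j \<in> Pow {..<j} \<times> Pow {..<j}"
  shows "diagonal_profile (Suc N) (weave N f g) ((weave N g f)\<inverse>) j = f j"
proof -
  obtain w where N: "N = j + w" using assms(1) le_iff_add by blast
  have "w + y \<le> N \<and> y \<in> snd (f j) \<longleftrightarrow> y \<in> snd (f j)"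
    and "Suc (w + y) \<le> N \<and> y \<in> fst (f j) \<longleftrightarrow> y \<in> fst (f j)" for y
    using assms(2) N by (auto simp: mem_Times_iff)
  then have "(w + y, y) \<in> weave N f g \<longleftrightarrow> y \<in> snd (f j)"
    and "(y, Suc (w + y)) \<in> weave N g f \<longleftrightarrow> y \<in> fst (f j)" for y
    by (simp_all add: weave_def N)
  moreover have "Suc N - j = Suc w" using N by simp
  ultimately show ?thesis by (simp add: diagonal_profile_def)
qed

lemma diagonal_profile_weave_main:
  assumes "f (Suc N) = (snd (g N), Suc ` fst (g N))" "g N \<in> Pow {..<N} \<times> Pow {..<N}"
  shows "diagonal_profile (Suc N) (weave N f g) ((weave N g f)\<inverse>) (Suc N) = f (Suc N)"
proof -
  have "y \<le> N \<and> y \<in> snd (g N) \<longleftrightarrow> y \<in> snd (g N)" for y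
    using assms(2) by (auto simp: mem_Times_iff)
  moreover have "0 < y \<and> (y - 1, y) \<in> weave N f g \<longleftrightarrow> y \<in> Suc ` fst (g N)" for y
    using assms(2) by (cases y) (auto simp: weave_def mem_Times_iff)
  ultimately show ?thesis
    unfolding assms(1) by (simp add: diagonal_profile_def weave_def)
qed

lemma weave_diagonal_profile:
  assumes "in_bounds (Suc N) H V"
    and "\<And>j. j \<le> N \<Longrightarrow> f j = diagonal_profile (Suc N) H V j"
    and "\<And>j. j \<le> N \<Longrightarrow> g j = diagonal_profile (Suc N) (V\<inverse>) (H\<inverse>) j"
  shows "weave N f g = H"
proof -
  have "(x, y) \<in> weave N f g \<longleftrightarrow> (x, y) \<in> H" for x y
  proof -
    have "x \<le> N" "y \<le> N" if "(x, y) \<in> H"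
      using assms(1) that unfolding in_bounds_def by auto
    then show ?thesis
      by (auto simp: weave_def assms(2,3) diagonal_profile_def)
  qed
  then show ?thesis by auto
qed

definition weavings :: "nat \<Rightarrow> ((nat \<Rightarrow> profile) \<times> (nat \<Rightarrow> profile)) set" where
  "weavings N = (\<Union>b\<in>Pow {..<N} \<times> Pow {..<N}. walks (Suc N) (snd b, Suc ` fst b) \<times> walks N b)"

lemma card_weavings: "card (weavings N) = weaving_sum N"
proof -
  have "card (weavings N) =
    (\<Sum>b\<in>Pow {..<N} \<times> Pow {..<N}. card (walks (Suc N) (snd b, Suc ` fst b) \<times> walks N b))"
    unfolding weavings_def
  proof (rule card_UN_disjoint)
    show "\<forall>b\<in>Pow {..<N} \<times> Pow {..<N}. \<forall>c\<in>Pow {..<N} \<times> Pow {..<N}. b \<noteq> c \<longrightarrow>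
      walks (Suc N) (snd b, Suc ` fst b) \<times> walks N b \<inter>
      walks (Suc N) (snd c, Suc ` fst c) \<times> walks N c = {}"
    proof (intro ballI impI)
      fix b c :: profile assume "b \<noteq> c"
      then have "walks N b \<inter> walks N c = {}" unfolding walks_def by blast
      then show "walks (Suc N) (snd b, Suc ` fst b) \<times> walks N b \<inter>
        walks (Suc N) (snd c, Suc ` fst c) \<times> walks N c = {}" by blast
    qed
  qed (simp_all add: finite_walks)
  then show ?thesis
    by (simp add: weaving_sum_def card_cartesian_product count_def mult.commute)
qed

lemma walks_bounded:
  assumes "f \<in> walks k a" "j \<le> k"
  shows "f j \<in> Pow {..<j} \<times> Pow {..<j}"
proof (cases j)
  case 0
  then show ?thesis using assms unfolding walks_def by simp
next
  case (Suc i)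
  then have "link i (f i) (f j)" using assms unfolding walks_def by auto
  then show ?thesis using link_succ_bounded Suc by blast
qed

definition truncate_at :: "nat \<Rightarrow> (nat \<Rightarrow> profile) \<Rightarrow> nat \<Rightarrow> profile" where
  "truncate_at m f j = (if j \<le> m then f j else ({}, {}))"

lemma truncated_diagonal_profile_walk:
  assumes "in_bounds (Suc N) H V" "m \<le> Suc N"
    and "\<forall>j<m. link j (diagonal_profile (Suc N) H V j) (diagonal_profile (Suc N) H V (Suc j))"
  shows "truncate_at m (diagonal_profile (Suc N) H V) \<in> walks m (diagonal_profile (Suc N) H V m)"
proof -
  have "diagonal_profile (Suc N) H V 0 = ({}, {})"
    using assms(1) unfolding in_bounds_def by (force simp: diagonal_profile_def)
  then show ?thesis using assms(3) unfolding walks_def by (auto simp: truncate_at_def)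
qed

lemma diagonal_profile_main:
  "diagonal_profile (Suc N) H V (Suc N) =
    (snd (diagonal_profile (Suc N) (V\<inverse>) (H\<inverse>) N), Suc ` fst (diagonal_profile (Suc N) (V\<inverse>) (H\<inverse>) N))"
proof -
  have "0 < y \<and> (y - 1, y) \<in> H \<longleftrightarrow> y \<in> Suc ` {y. (y, Suc y) \<in> H}" for y
    by (cases y) auto
  then show ?thesis by (auto simp: diagonal_profile_def)
qed

text \<open>
  Reading off the profiles of the two halves is inverse to weaving two walks that agree on the main
  diagonal.
\<close>

lemma card_layouts: "card (layouts (Suc N)) = weaving_sum N"
proof -
  let ?\<Phi> = "\<lambda>(H, V). (truncate_at (Suc N) (diagonal_profile (Suc N) H V),
    truncate_at N (diagonal_profile (Suc N) (V\<inverse>) (H\<inverse>)))"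
  let ?\<Psi> = "\<lambda>(f, g). (weave N f g, (weave N g f)\<inverse>)"
  have "bij_betw ?\<Phi> (layouts (Suc N)) (weavings N)"
  proof (rule bij_betw_byWitness[where f' = ?\<Psi>])
    show "\<forall>a\<in>layouts (Suc N). ?\<Psi> (?\<Phi> a) = a"
    proof
      fix a assume a: "a \<in> layouts (Suc N)"
      obtain H V where HV: "a = (H, V)" by (cases a)
      then have b: "in_bounds (Suc N) H V" using a by (simp add: layouts_def)
      then have b': "in_bounds (Suc N) (V\<inverse>) (H\<inverse>)" by (simp add: in_bounds_transpose)
      show "?\<Psi> (?\<Phi> a) = a"
        unfolding HV using weave_diagonal_profile[OF b] weave_diagonal_profile[OF b']
        by (simp add: truncate_at_def)
    qed
    show "?\<Phi> ` layouts (Suc N) \<subseteq> weavings N"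
    proof
      fix p assume "p \<in> ?\<Phi> ` layouts (Suc N)"
      then obtain H V where p: "p = ?\<Phi> (H, V)" and HV: "(H, V) \<in> layouts (Suc N)" by auto
      then have b: "in_bounds (Suc N) H V" by (simp add: layouts_def)
      then have b': "in_bounds (Suc N) (V\<inverse>) (H\<inverse>)" by (simp add: in_bounds_transpose)
      note links = layouts_iff_links[OF b, THEN iffD1, OF HV]
      let ?b = "diagonal_profile (Suc N) (V\<inverse>) (H\<inverse>) N"
      have g: "truncate_at N (diagonal_profile (Suc N) (V\<inverse>) (H\<inverse>)) \<in> walks N ?b"
        by (rule truncated_diagonal_profile_walk[OF b']) (use links in auto)
      moreover have "truncate_at (Suc N) (diagonal_profile (Suc N) H V) \<in> walks (Suc N) (snd ?b, Suc ` fst ?b)"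
        using truncated_diagonal_profile_walk[OF b order_refl] links
        unfolding diagonal_profile_main[symmetric] by blast
      moreover have "?b \<in> Pow {..<N} \<times> Pow {..<N}"
        using walks_bounded[OF g order_refl] by (simp add: truncate_at_def)
      ultimately show "p \<in> weavings N"
        unfolding p weavings_def prod.case by (intro UN_I[of ?b] SigmaI)
    qed
    have \<Psi>: "?\<Phi> (weave N f g, (weave N g f)\<inverse>) = (f, g)"
      "(weave N f g, (weave N g f)\<inverse>) \<in> layouts (Suc N)" if fg: "(f, g) \<in> weavings N" for f g
    proof -
      obtain b where f: "f \<in> walks (Suc N) (snd b, Suc ` fst b)" and g: "g \<in> walks N b"
        using fg unfolding weavings_def by auto
      have fb: "f j \<in> Pow {..<j} \<times> Pow {..<j}" if "j \<le> N" for j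
        using walks_bounded[OF f] that by simp
      have gb: "g j \<in> Pow {..<j} \<times> Pow {..<j}" if "j \<le> N" for j
        using walks_bounded[OF g] that by simp
      have "f (Suc N) = (snd (g N), Suc ` fst (g N))"
        using f g unfolding walks_def by auto
      then have "diagonal_profile (Suc N) (weave N f g) ((weave N g f)\<inverse>) (Suc N) = f (Suc N)"
        using gb by (intro diagonal_profile_weave_main) simp_all
      then have pf: "diagonal_profile (Suc N) (weave N f g) ((weave N g f)\<inverse>) j = f j"
        if "j \<le> Suc N" for j
        using that diagonal_profile_weave[of j N f g] fb by (cases "j = Suc N") auto
      have pg: "diagonal_profile (Suc N) (weave N g f) ((weave N f g)\<inverse>) j = g j" if "j \<le> N" for j
        using that diagonal_profile_weave[of j N g f] gb by auto
      have "truncate_at (Suc N) f = f" "truncate_at N g = g"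
        using f g unfolding walks_def truncate_at_def by auto
      moreover have "truncate_at (Suc N) (diagonal_profile (Suc N) (weave N f g) ((weave N g f)\<inverse>)) = truncate_at (Suc N) f"
        by (rule ext) (simp add: truncate_at_def pf)
      moreover have "truncate_at N (diagonal_profile (Suc N) (weave N g f) ((weave N f g)\<inverse>)) = truncate_at N g"
        by (rule ext) (simp add: truncate_at_def pg)
      ultimately show "?\<Phi> (weave N f g, (weave N g f)\<inverse>) = (f, g)"
        by (simp only: prod.case converse_converse)
      have b: "in_bounds (Suc N) (weave N f g) ((weave N g f)\<inverse>)"
        by (rule in_bounds_weave) (use fb gb in auto)
      show "(weave N f g, (weave N g f)\<inverse>) \<in> layouts (Suc N)"
        using f g unfolding layouts_iff_links[OF b] walks_def by (simp add: pf pg)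
    qed
    then show "\<forall>a\<in>weavings N. ?\<Phi> (?\<Psi> a) = a" "?\<Psi> ` weavings N \<subseteq> layouts (Suc N)"
      by auto
  qed
  from bij_betw_same_card[OF this] show ?thesis by (simp only: card_weavings)
qed

section \<open>Tatami tilings as layouts\<close>

abbreviation hdimer :: "square \<Rightarrow> tile" where
  "hdimer \<equiv> \<lambda>(x, y). {(x, y), (Suc x, y)}"

abbreviation vdimer :: "square \<Rightarrow> tile" where
  "vdimer \<equiv> \<lambda>(x, y). {(x, y), (x, Suc y)}"

lemma tiling_tile_cases:
  assumes "monomer_dimer_tiling n T" "t \<in> T"
  obtains s where "t = {s}" | s where "t = hdimer s" | s where "t = vdimer s"
  using assms
  unfolding monomer_dimer_tiling_def monomer_def dimer_def horizontal_dimer_def vertical_dimer_def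
  by auto

lemma tiling_unique_tile:
  assumes "monomer_dimer_tiling n T" "t \<in> T" "t' \<in> T" "s \<in> t" "s \<in> t'"
  shows "t = t'"
  using assms unfolding monomer_dimer_tiling_def partition_on_def disjoint_def by blast

lemma tiling_tile_in_grid:
  assumes "monomer_dimer_tiling n T" "t \<in> T" "(x, y) \<in> t"
  shows "x < n \<and> y < n"
  using assms unfolding monomer_dimer_tiling_def partition_on_def grid_def by blast

lemma tiling_covers:
  assumes "monomer_dimer_tiling n T" "x < n" "y < n"
  obtains t where "t \<in> T" "(x, y) \<in> t"
  using assms unfolding monomer_dimer_tiling_def partition_on_def grid_def by blast

text \<open>
  The combinatorial form of the tatami condition at the grid point \<open>(x + 1, y + 1)\<close>.
\<close>

definition face_covered :: "tile set \<Rightarrow> nat \<Rightarrow> nat \<Rightarrow> bool" where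
  "face_covered T x y \<longleftrightarrow>
    hdimer (x, y) \<in> T \<or> vdimer (x, y) \<in> T \<or> hdimer (x, Suc y) \<in> T \<or> vdimer (Suc x, y) \<in> T"

definition face :: "nat \<Rightarrow> nat \<Rightarrow> square set" where
  "face x y = {(x, y), (Suc x, y), (x, Suc y), (Suc x, Suc y)}"

text \<open>
  Of two diagonally opposite squares of a face no dimer contains both, so a tile with two squares in the face
  is one of the four dimers in it.
\<close>

lemma face_covered_iff_shared:
  assumes T: "monomer_dimer_tiling n T"
  shows "face_covered T x y \<longleftrightarrow> (\<exists>t\<in>T. \<exists>s\<in>t. \<exists>s'\<in>t. s \<noteq> s' \<and> s \<in> face x y \<and> s' \<in> face x y)"
proof
  assume "face_covered T x y"
  then consider "hdimer (x, y) \<in> T" | "vdimer (x, y) \<in> T" | "hdimer (x, Suc y) \<in> T"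
    | "vdimer (Suc x, y) \<in> T" unfolding face_covered_def by blast
  then obtain q q' where "{q, q'} \<in> T" "q \<noteq> q'" "q \<in> face x y" "q' \<in> face x y"
  proof cases
    case 1
    then show ?thesis using that[of "(x, y)" "(Suc x, y)"] by (simp add: face_def)
  next
    case 2
    then show ?thesis using that[of "(x, y)" "(x, Suc y)"] by (simp add: face_def)
  next
    case 3
    then show ?thesis using that[of "(x, Suc y)" "(Suc x, Suc y)"] by (simp add: face_def)
  next
    case 4
    then show ?thesis using that[of "(Suc x, y)" "(Suc x, Suc y)"] by (simp add: face_def)
  qed
  then show "\<exists>t\<in>T. \<exists>s\<in>t. \<exists>s'\<in>t. s \<noteq> s' \<and> s \<in> face x y \<and> s' \<in> face x y"
    by (intro bexI[of _ "{q, q'}"] bexI[of _ q] bexI[of _ q']) auto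
next
  assume "\<exists>t\<in>T. \<exists>s\<in>t. \<exists>s'\<in>t. s \<noteq> s' \<and> s \<in> face x y \<and> s' \<in> face x y"
  then obtain t s s' where t: "t \<in> T" "s \<in> t" "s' \<in> t" "s \<noteq> s'" "s \<in> face x y" "s' \<in> face x y"
    by blast
  from tiling_tile_cases[OF T t(1)] show "face_covered T x y"
  proof cases
    case (2 q)
    then show ?thesis using t unfolding face_def face_covered_def by (cases q) auto
  next
    case (3 q)
    then show ?thesis using t unfolding face_def face_covered_def by (cases q) auto
  qed (use t in auto)
qed

lemma tatami_imp_face_covered:
  assumes T: "monomer_dimer_tiling n T" and tat: "tatami T" and x: "Suc x < n" and y: "Suc y < n"
  shows "face_covered T x y"
proof (rule ccontr)
  assume no: "\<not> face_covered T x y"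
  have "\<exists>t. \<forall>s\<in>face x y. t s \<in> T \<and> s \<in> t s"
  proof (rule bchoice, rule ballI)
    fix s assume "s \<in> face x y"
    then have "fst s < n" "snd s < n" using x y unfolding face_def by auto
    then show "\<exists>t. t \<in> T \<and> s \<in> t" using tiling_covers[OF T] by (metis prod.collapse)
  qed
  then obtain t where t: "\<And>s. s \<in> face x y \<Longrightarrow> t s \<in> T" "\<And>s. s \<in> face x y \<Longrightarrow> s \<in> t s" by blast
  have "inj_on t (face x y)"
    using no t unfolding face_covered_iff_shared[OF T] by (intro inj_onI) metis
  moreover have "card (face x y) = 4" by (simp add: face_def)
  ultimately have "card (t ` face x y) = 4" by (simp add: card_image)
  moreover have "(real x + 1, real y + 1) \<in> tile_region (t s)" if s: "s \<in> face x y" for s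
  proof -
    have "(real x + 1, real y + 1) \<in> square_region s"
      using s unfolding face_def square_region_def by auto
    then show ?thesis using t(2)[OF s] unfolding tile_region_def by blast
  qed
  moreover have "t ` face x y \<subseteq> T" using t(1) by blast
  ultimately show False using tat unfolding tatami_def by blast
qed

lemma adjacent_unit_intervals:
  obtains a :: nat where "\<And>i::nat. real i \<le> p \<Longrightarrow> p \<le> real i + 1 \<Longrightarrow> i = a \<or> i = Suc a"
proof
  fix i :: nat assume "real i \<le> p" "p \<le> real i + 1"
  \<comment> \<open>The least possible \<open>i\<close> is \<open>\<lceil>p\<rceil> - 1\<close>, except that \<open>p = 0\<close> would give \<open>-1\<close>, which becomes \<open>0\<close>.\<close>
  then show "i = nat (\<lceil>p\<rceil> - 1) \<or> i = Suc (nat (\<lceil>p\<rceil> - 1))" by linarith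
qed

text \<open>
  Each tile at a point \<open>p\<close> contains a square at \<open>p\<close>, and different tiles give different squares. A
  coordinate of \<open>p\<close> lies in at most two closed unit intervals, so the squares at \<open>p\<close> all belong to
  one face. Four tiles at \<open>p\<close> use up that face, and a dimer inside it is then impossible.
\<close>

lemma face_covered_imp_tatami:
  assumes T: "monomer_dimer_tiling n T"
    and cov: "\<And>x y. Suc x < n \<Longrightarrow> Suc y < n \<Longrightarrow> face_covered T x y"
  shows "tatami T"
  unfolding tatami_def
proof
  assume "\<exists>p. \<exists>S\<subseteq>T. card S = 4 \<and> (\<forall>t\<in>S. p \<in> tile_region t)"
  then obtain px py S where S: "S \<subseteq> T" "card S = 4" "\<forall>t\<in>S. (px, py) \<in> tile_region t" by auto
  have "\<exists>q. \<forall>t\<in>S. q t \<in> t \<and> (px, py) \<in> square_region (q t)"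
    by (rule bchoice) (use S(3) in \<open>unfold tile_region_def, blast\<close>)
  then obtain q where q: "\<And>t. t \<in> S \<Longrightarrow> q t \<in> t" "\<And>t. t \<in> S \<Longrightarrow> (px, py) \<in> square_region (q t)"
    by blast
  have "inj_on q S"
    using q(1) S(1) tiling_unique_tile[OF T] by (intro inj_onI) (metis subsetD)
  then have card: "card (q ` S) = 4" using S(2) by (simp add: card_image)
  obtain a where a: "\<And>i::nat. real i \<le> px \<Longrightarrow> px \<le> real i + 1 \<Longrightarrow> i = a \<or> i = Suc a"
    using adjacent_unit_intervals by blast
  obtain b where b: "\<And>i::nat. real i \<le> py \<Longrightarrow> py \<le> real i + 1 \<Longrightarrow> i = b \<or> i = Suc b"
    using adjacent_unit_intervals by blast
  have "q ` S \<subseteq> face a b"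
  proof (rule image_subsetI)
    fix t assume "t \<in> S"
    obtain i j where "q t = (i, j)" by (cases "q t")
    then show "q t \<in> face a b"
      using q(2)[OF \<open>t \<in> S\<close>] a[of i] b[of j] by (auto simp: square_region_def face_def)
  qed
  moreover have "card (face a b) = 4" "finite (face a b)" by (simp_all add: face_def)
  ultimately have eq: "q ` S = face a b" using card by (metis card_subset_eq)
  have "(Suc a, Suc b) \<in> q ` S" unfolding eq by (simp add: face_def)
  then obtain t0 where "t0 \<in> S" "(Suc a, Suc b) = q t0" by blast
  then have "t0 \<in> T" "(Suc a, Suc b) \<in> t0" using q(1) S(1) by auto
  then have "Suc a < n" "Suc b < n" using tiling_tile_in_grid[OF T] by blast+
  then obtain t s s' where t: "t \<in> T" "s \<in> t" "s' \<in> t" "s \<noteq> s'" "s \<in> q ` S" "s' \<in> q ` S"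
    using cov unfolding face_covered_iff_shared[OF T] eq by metis
  obtain u u' where u: "u \<in> S" "s = q u" "u' \<in> S" "s' = q u'" using t(5,6) by blast
  have "u = t" "u' = t" using tiling_unique_tile[OF T] t u q(1) S(1) by (metis subsetD)+
  then show False using t(4) u by simp
qed

definition horizontal_part :: "tile set \<Rightarrow> square set" where
  "horizontal_part T = {s. hdimer s \<in> T}"

definition vertical_part :: "tile set \<Rightarrow> square set" where
  "vertical_part T = {s. vdimer s \<in> T}"

lemma parts_in_layouts:
  assumes "T \<in> tatami_tilings n"
  shows "(horizontal_part T, vertical_part T) \<in> layouts n"
proof -
  have T: "monomer_dimer_tiling n T" and "tatami T" using assms unfolding tatami_tilings_def by auto
  then have face: "face_covered T x y" if "Suc x < n" "Suc y < n" for x y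
    using tatami_imp_face_covered that by blast
  let ?H = "horizontal_part T" and ?V = "vertical_part T"
  have H: "(x, y) \<in> ?H \<longleftrightarrow> {(x, y), (Suc x, y)} \<in> T"
    and V: "(x, y) \<in> ?V \<longleftrightarrow> {(x, y), (x, Suc y)} \<in> T" for x y
    unfolding horizontal_part_def vertical_part_def by simp_all
  have "in_bounds n ?H ?V"
  proof -
    have "Suc x < n \<and> y < n" if "(x, y) \<in> ?H" for x y
      using that tiling_tile_in_grid[OF T, of "{(x, y), (Suc x, y)}" "Suc x" y] by (simp add: H)
    moreover have "x < n \<and> Suc y < n" if "(x, y) \<in> ?V" for x y
      using that tiling_tile_in_grid[OF T, of "{(x, y), (x, Suc y)}" x "Suc y"] by (simp add: V)
    ultimately show ?thesis unfolding in_bounds_def by blast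
  qed
  moreover have "cell_fits n ?H ?V x y" for x y
  proof -
    have same: "t = t'" if "t \<in> T" "t' \<in> T" "(x, y) \<in> t" "(x, y) \<in> t'" for t t'
      using that tiling_unique_tile[OF T] by blast
    let ?h = "{(x, y), (Suc x, y)}" and ?v = "{(x, y), (x, Suc y)}"
      and ?h' = "{(x - 1, y), (Suc (x - 1), y)}" and ?v' = "{(x, y - 1), (x, Suc (y - 1))}"
    have "at_most_one (?v \<in> T) (?h \<in> T) (0 < x \<and> ?h' \<in> T) (0 < y \<and> ?v' \<in> T)"
      unfolding at_most_one_def
      using same[of ?v ?h] same[of ?v ?h'] same[of ?v ?v'] same[of ?h ?h'] same[of ?h ?v'] same[of ?h' ?v']
      by (auto simp: doubleton_eq_iff)
    moreover have "?h \<in> T \<or> ?v \<in> T \<or> {(x, Suc y), (Suc x, Suc y)} \<in> T \<or> {(Suc x, y), (Suc x, Suc y)} \<in> T"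
      if "Suc x < n" "Suc y < n"
      using face[OF that] by (simp add: face_covered_def)
    ultimately show ?thesis unfolding cell_fits_def H V by blast
  qed
  ultimately show ?thesis by (simp add: layouts_def)
qed

lemma singleton_ne_dimer: "{s} \<noteq> hdimer q" "{s} \<noteq> vdimer q"
  by (cases q; auto)+

lemma hdimer_inject: "hdimer p = hdimer q \<longleftrightarrow> p = q"
  and vdimer_inject: "vdimer p = vdimer q \<longleftrightarrow> p = q"
  and hdimer_ne_vdimer: "hdimer p \<noteq> vdimer q"
  by (cases p; cases q; auto simp: doubleton_eq_iff)+

text \<open>
  The dimers of a layout, completed by monomers on all squares that they leave free.
\<close>

definition tiling_of :: "nat \<Rightarrow> square set \<Rightarrow> square set \<Rightarrow> tile set" where
  "tiling_of n H V = hdimer ` H \<union> vdimer ` V \<union>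
     {{s} | s. s \<in> grid n \<and> s \<notin> \<Union> (hdimer ` H) \<and> s \<notin> \<Union> (vdimer ` V)}"

lemma tiling_of_parts:
  assumes T: "monomer_dimer_tiling n T"
  shows "tiling_of n (horizontal_part T) (vertical_part T) = T"
proof (intro equalityI subsetI)
  let ?H = "horizontal_part T" and ?V = "vertical_part T"
  have dimers: "hdimer ` ?H \<subseteq> T" "vdimer ` ?V \<subseteq> T"
    unfolding horizontal_part_def vertical_part_def by auto
  fix t
  {
    assume t: "t \<in> tiling_of n ?H ?V"
    show "t \<in> T"
    proof (cases "t \<in> hdimer ` ?H \<union> vdimer ` ?V")
      case True
      then show ?thesis using dimers by blast
    next
      case False
      then obtain s where s: "t = {s}" "s \<in> grid n" "s \<notin> \<Union> (hdimer ` ?H)" "s \<notin> \<Union> (vdimer ` ?V)"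
        using t unfolding tiling_of_def by blast
      obtain t' where t': "t' \<in> T" "s \<in> t'"
        using s(2) T unfolding monomer_dimer_tiling_def partition_on_def by blast
      from tiling_tile_cases[OF T t'(1)] have "t' = {s}"
      proof cases
        case (2 q)
        then have "q \<in> ?H" using t' by (simp add: horizontal_part_def)
        then show ?thesis using s(3) t' 2 by blast
      next
        case (3 q)
        then have "q \<in> ?V" using t' by (simp add: vertical_part_def)
        then show ?thesis using s(4) t' 3 by blast
      qed (use t' in auto)
      then show ?thesis using t' s by simp
    qed
  next
    assume t: "t \<in> T"
    from tiling_tile_cases[OF T t] show "t \<in> tiling_of n ?H ?V"
    proof cases
      case (1 s)
      have "s \<in> grid n" using t 1 T unfolding monomer_dimer_tiling_def partition_on_def by blast
      moreover have "s \<notin> u" if "u \<in> hdimer ` ?H \<union> vdimer ` ?V" for u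
      proof
        assume "s \<in> u"
        moreover have "u \<in> T" using that dimers by blast
        moreover have "s \<in> t" using 1 by simp
        ultimately have "u = {s}" using tiling_unique_tile[OF T] t 1 by metis
        with that have "{s} \<in> hdimer ` ?H \<or> {s} \<in> vdimer ` ?V" by simp
        then show False
        proof
          assume "{s} \<in> hdimer ` ?H"
          then show False by (rule imageE) (use singleton_ne_dimer(1) in simp)
        next
          assume "{s} \<in> vdimer ` ?V"
          then show False by (rule imageE) (use singleton_ne_dimer(2) in simp)
        qed
      qed
      ultimately show ?thesis unfolding tiling_of_def 1 by blast
    next
      case (2 q)
      then show ?thesis using t unfolding tiling_of_def horizontal_part_def by blast
    next
      case (3 q)
      then show ?thesis using t unfolding tiling_of_def vertical_part_def by blast
    qed
  }
qed

lemma parts_tiling_of: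
  "horizontal_part (tiling_of n H V) = H" "vertical_part (tiling_of n H V) = V"
proof -
  have "hdimer s \<in> tiling_of n H V \<longleftrightarrow> s \<in> H" for s
    unfolding tiling_of_def using hdimer_inject hdimer_ne_vdimer singleton_ne_dimer
    by (smt (verit) UnE UnI1 image_iff mem_Collect_eq)
  then show "horizontal_part (tiling_of n H V) = H" unfolding horizontal_part_def by simp
  have "vdimer s \<in> tiling_of n H V \<longleftrightarrow> s \<in> V" for s
    unfolding tiling_of_def using vdimer_inject hdimer_ne_vdimer singleton_ne_dimer
    by (smt (verit) UnE UnI1 UnI2 image_iff mem_Collect_eq)
  then show "vertical_part (tiling_of n H V) = V" unfolding vertical_part_def by simp
qed

lemma at_most_one_unique:
  assumes "at_most_one a b c d"
    and "t = p \<and> a \<or> t = q \<and> b \<or> t = r \<and> c \<or> t = s \<and> d"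
    and "t' = p \<and> a \<or> t' = q \<and> b \<or> t' = r \<and> c \<or> t' = s \<and> d"
  shows "t = t'"
  using assms unfolding at_most_one_def by auto

lemma tiling_of_in_tatami_tilings:
  assumes "(H, V) \<in> layouts n"
  shows "tiling_of n H V \<in> tatami_tilings n"
proof -
  have H: "Suc x < n" "y < n" if "(x, y) \<in> H" for x y
    using assms that unfolding layouts_def in_bounds_def by auto
  have V: "x < n" "Suc y < n" if "(x, y) \<in> V" for x y
    using assms that unfolding layouts_def in_bounds_def by auto
  have fits: "cell_fits n H V x y" if "x < n" "y < n" for x y
    using assms that unfolding layouts_def by auto
  let ?T = "tiling_of n H V"
  define D where "D = hdimer ` H \<union> vdimer ` V"
  have mem: "t = vdimer (x, y) \<and> (x, y) \<in> V \<or> t = hdimer (x, y) \<and> (x, y) \<in> H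
      \<or> t = hdimer (x - 1, y) \<and> 0 < x \<and> (x - 1, y) \<in> H
      \<or> t = vdimer (x, y - 1) \<and> 0 < y \<and> (x, y - 1) \<in> V"
    if t: "t \<in> D" "(x, y) \<in> t" for t x y
    using t(1) unfolding D_def
  proof (elim UnE imageE)
    fix p assume p: "t = hdimer p" "p \<in> H"
    obtain a b where ab: "p = (a, b)" by (cases p)
    then have "x = a \<and> y = b \<or> x = Suc a \<and> y = b" using p(1) t(2) by simp
    then show ?thesis
    proof
      assume "x = a \<and> y = b"
      then show ?thesis using p ab by (intro disjI2[OF disjI1]) simp
    next
      assume "x = Suc a \<and> y = b"
      then have "t = hdimer (x - 1, y) \<and> 0 < x \<and> (x - 1, y) \<in> H" using p ab by simp
      then show ?thesis by (intro disjI2[OF disjI2[OF disjI1]])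
    qed
  next
    fix p assume p: "t = vdimer p" "p \<in> V"
    obtain a b where ab: "p = (a, b)" by (cases p)
    then have "x = a \<and> y = b \<or> x = a \<and> y = Suc b" using p(1) t(2) by simp
    then show ?thesis
    proof
      assume "x = a \<and> y = b"
      then show ?thesis using p ab by (intro disjI1) simp
    next
      assume "x = a \<and> y = Suc b"
      then have "t = vdimer (x, y - 1) \<and> 0 < y \<and> (x, y - 1) \<in> V" using p ab by simp
      then show ?thesis by (intro disjI2[OF disjI2[OF disjI2]])
    qed
  qed
  have dimers_unique: "t = t'"
    if "t \<in> D" "t' \<in> D" "(x, y) \<in> t" "(x, y) \<in> t'" "x < n" "y < n" for t t' x y
    using at_most_one_unique[OF _ mem[OF that(1,3)] mem[OF that(2,4)]] fits[OF that(5,6)]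
    unfolding cell_fits_def by (elim conjE)
  have in_grid: "t \<subseteq> grid n" if "t \<in> D" for t
    using that H V unfolding grid_def D_def by fastforce
  have T_eq: "?T = D \<union> {{s} | s. s \<in> grid n \<and> s \<notin> \<Union> D}" unfolding tiling_of_def D_def by auto
  have "partition_on (grid n) ?T"
    unfolding partition_on_def
  proof (intro conjI)
    show "\<Union> ?T = grid n" using in_grid unfolding T_eq by blast
    have "{} \<notin> D" unfolding D_def by auto
    then show "{} \<notin> ?T" unfolding T_eq by blast
    show "disjoint ?T"
      unfolding disjoint_def
    proof (intro ballI impI)
      fix t t' assume t: "t \<in> ?T" "t' \<in> ?T" "t \<noteq> t'"
      show "t \<inter> t' = {}"
      proof (rule ccontr)
        assume "t \<inter> t' \<noteq> {}"
        then obtain x y where xy: "(x, y) \<in> t" "(x, y) \<in> t'" by auto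
        show False
        proof (cases "(x, y) \<in> \<Union> D")
          case True
          then have "t \<in> D" "t' \<in> D" using t xy unfolding T_eq by blast+
          moreover from this have "x < n" "y < n" using in_grid xy unfolding grid_def by blast+
          ultimately show False using dimers_unique xy t by blast
        next
          case False
          then have "t = {(x, y)}" "t' = {(x, y)}" using t xy unfolding T_eq by blast+
          then show False using t by simp
        qed
      qed
    qed
  qed
  moreover have "\<forall>t\<in>?T. monomer t \<or> dimer t"
    unfolding tiling_of_def monomer_def dimer_def horizontal_dimer_def vertical_dimer_def by auto
  ultimately have T: "monomer_dimer_tiling n ?T" unfolding monomer_dimer_tiling_def by blast
  have "tatami ?T"
  proof (rule face_covered_imp_tatami[OF T])
    fix x y assume "Suc x < n" "Suc y < n"
    then have some: "(x, y) \<in> H \<or> (x, y) \<in> V \<or> (x, Suc y) \<in> H \<or> (Suc x, y) \<in> V"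
      using fits[of x y] unfolding cell_fits_def by auto
    have h: "hdimer s \<in> ?T" if "s \<in> H" for s
      using that unfolding tiling_of_def by blast
    have v: "vdimer s \<in> ?T" if "s \<in> V" for s
      using that unfolding tiling_of_def by blast
    show "face_covered ?T x y"
      using some h[of "(x, y)"] v[of "(x, y)"] h[of "(x, Suc y)"] v[of "(Suc x, y)"]
      unfolding face_covered_def by argo
  qed
  then show ?thesis using T unfolding tatami_tilings_def by blast
qed

lemma card_tatami_tilings: "card (tatami_tilings n) = card (layouts n)"
proof (rule bij_betw_same_card)
  show "bij_betw (\<lambda>T. (horizontal_part T, vertical_part T)) (tatami_tilings n) (layouts n)"
  proof (rule bij_betw_byWitness[where f' = "\<lambda>(H, V). tiling_of n H V"])
    show "\<forall>T\<in>tatami_tilings n. (case (horizontal_part T, vertical_part T) of (H, V) \<Rightarrow> tiling_of n H V) = T"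
      by (simp add: tatami_tilings_def tiling_of_parts)
  qed (auto simp: parts_tiling_of parts_in_layouts tiling_of_in_tatami_tilings)
qed

theorem corollary1:
  fixes n :: nat
  assumes "n \<ge> 1"
  shows "int (card (tatami_tilings n)) = 2 ^ (n - 1) * (3 * int n - 4) + 2"
proof -
  obtain N where n: "n = Suc N" using assms by (cases n) auto
  have "card (tatami_tilings n) = complement_sum (Suc N)"
    unfolding n card_tatami_tilings card_layouts weaving_sum_eq ..
  then show ?thesis using complement_sum_closed_form[of N] by (simp only: n diff_Suc_1)
qed

end
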